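(* Let $\mathbb{F}$ be a field of characteristic $0$. For every growing parameter $N\in\mathbb{N}$ there is a multilinear polynomial $Q\in\mathbb{F}[x_1,\dots,x_N]$ which is unsatisfiable over $\{0,1\}^N$ such that: (1) there is a multilinear functional refutation $G(\mathbf{x})$ of $Q$ which is computable by a syntactically multilinear circuit of size $\mathrm{poly}(N)$ and depth $O(\log^2 N)$; (2) every multilinear-$\mathsf{NC}^1$-$\mathsf{IPS}_{\mathsf{LIN}'}$ refutation of $Q$ (i.e. an $\mathsf{IPS}_{\mathsf{LIN}'}$ refutation computed by a multilinear formula) has size $N^{\Omega(\log N)}$. *)

theory Defs
  imports Complex_Main "HOL-Library.Poly_Mapping"
begin

(* Multivariate polynomials over 'a in variables x_0, x_1, ... (index i stands for x_{i+1}):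
   a polynomial is a finitely supported map from monomials (exponent vectors) to coefficients. *)
type_synonym 'a mpoly = "(nat \<Rightarrow>\<^sub>0 nat) \<Rightarrow>\<^sub>0 'a"

definition Xv :: "nat \<Rightarrow> 'a::comm_ring_1 mpoly" where
  "Xv i = Poly_Mapping.single (Poly_Mapping.single i 1) 1"

definition pconst :: "'a::comm_ring_1 \<Rightarrow> 'a mpoly" where
  "pconst c = Poly_Mapping.single 0 c"

definition peval :: "'a::comm_ring_1 mpoly \<Rightarrow> (nat \<Rightarrow> 'a) \<Rightarrow> 'a" where
  "peval p a = (\<Sum>m\<in>Poly_Mapping.keys p. Poly_Mapping.lookup p m * (\<Prod>i\<in>Poly_Mapping.keys m. a i ^ Poly_Mapping.lookup m i))"

definition pvars :: "'a::zero mpoly \<Rightarrow> nat set" where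
  "pvars p = \<Union> (Poly_Mapping.keys ` Poly_Mapping.keys p)"

definition multilinear :: "'a::zero mpoly \<Rightarrow> bool" where
  "multilinear p \<longleftrightarrow> (\<forall>m\<in>Poly_Mapping.keys p. \<forall>i. Poly_Mapping.lookup m i \<le> 1)"

definition bool_pt :: "nat \<Rightarrow> (nat \<Rightarrow> 'a::comm_ring_1) \<Rightarrow> bool" where
  "bool_pt N a \<longleftrightarrow> (\<forall>i<N. a i = 0 \<or> a i = 1) \<and> (\<forall>i\<ge>N. a i = 0)"

definition unsat_bool :: "nat \<Rightarrow> 'a::comm_ring_1 mpoly \<Rightarrow> bool" where
  "unsat_bool N Q \<longleftrightarrow> (\<forall>a. bool_pt N a \<longrightarrow> peval Q a \<noteq> 0)"

definition ml_functional_refutation :: "nat \<Rightarrow> 'a::field mpoly \<Rightarrow> 'a mpoly \<Rightarrow> bool" where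
  "ml_functional_refutation N Q G \<longleftrightarrow> multilinear G \<and> pvars G \<subseteq> {..<N} \<and>
     (\<forall>a. bool_pt N a \<longrightarrow> peval G a * peval Q a = 1)"

(* IPS_LIN' refutation g of Q: g*Q + sum_i h_i (x_i^2 - x_i) = 1 in F[x_1..x_N];
   the refutation is the polynomial g (its size is the size of g). *)
definition ips_lin'_refutation :: "nat \<Rightarrow> 'a::field mpoly \<Rightarrow> 'a mpoly \<Rightarrow> bool" where
  "ips_lin'_refutation N Q g \<longleftrightarrow> pvars g \<subseteq> {..<N} \<and>
     (\<exists>h. (\<forall>i. pvars (h i) \<subseteq> {..<N}) \<and>
          g * Q + (\<Sum>i<N. h i * (Xv i ^ 2 - Xv i)) = 1)"

(* Algebraic formulas / circuits with fan-in 2 gates. A term read as a tree is a formula;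
   read as a DAG (identical subterms shared) it is a circuit. *)
datatype 'a aterm = AVar nat | AConst 'a | AAdd "'a aterm" "'a aterm" | AMul "'a aterm" "'a aterm"

primrec ev :: "'a::comm_ring_1 aterm \<Rightarrow> 'a mpoly" where
  "ev (AVar i) = Xv i"
| "ev (AConst c) = pconst c"
| "ev (AAdd s t) = ev s + ev t"
| "ev (AMul s t) = ev s * ev t"

primrec subterms :: "'a aterm \<Rightarrow> 'a aterm set" where
  "subterms (AVar i) = {AVar i}"
| "subterms (AConst c) = {AConst c}"
| "subterms (AAdd s t) = insert (AAdd s t) (subterms s \<union> subterms t)"
| "subterms (AMul s t) = insert (AMul s t) (subterms s \<union> subterms t)"

primrec tvars :: "'a aterm \<Rightarrow> nat set" where
  "tvars (AVar i) = {i}"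
| "tvars (AConst c) = {}"
| "tvars (AAdd s t) = tvars s \<union> tvars t"
| "tvars (AMul s t) = tvars s \<union> tvars t"

primrec depth :: "'a aterm \<Rightarrow> nat" where
  "depth (AVar i) = 0"
| "depth (AConst c) = 0"
| "depth (AAdd s t) = Suc (max (depth s) (depth t))"
| "depth (AMul s t) = Suc (max (depth s) (depth t))"

primrec fsize :: "'a aterm \<Rightarrow> nat" where
  "fsize (AVar i) = 1"
| "fsize (AConst c) = 1"
| "fsize (AAdd s t) = Suc (fsize s + fsize t)"
| "fsize (AMul s t) = Suc (fsize s + fsize t)"

definition csize :: "'a aterm \<Rightarrow> nat" where
  "csize t = card (subterms t)"

definition syntactically_multilinear :: "'a aterm \<Rightarrow> bool" where
  "syntactically_multilinear t \<longleftrightarrow>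
     (\<forall>s1 s2. AMul s1 s2 \<in> subterms t \<longrightarrow> tvars s1 \<inter> tvars s2 = {})"

definition multilinear_formula :: "'a::comm_ring_1 aterm \<Rightarrow> bool" where
  "multilinear_formula t \<longleftrightarrow> (\<forall>s\<in>subterms t. multilinear (ev s))"

end

theory Submission
  imports Defs
begin

text \<open>
  If \<open>Q\<close> and a refutation \<open>g\<close> are restricted to the Boolean cube, then \<open>g = 1 / Q\<close>, so it suffices
  to find a polynomial \<open>G\<close> without zeros on the cube that has small syntactically multilinear circuits
  but no small multilinear formulas, and to let \<open>Q\<close> be the multilinear extension of \<open>1 / G\<close>. We take
  \<open>G = 1 + 2 f\<close> with \<open>f\<close> integer valued on the cube; this has no zeros in characteristic \<open>0\<close>.

  The lower bound is Raz's rank method. For a partition of the main variables into \<open>Y\<close> and its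
  complement, consider the rank of the matrix of values of a function on the cube. A multilinear
  formula is a sum of few products of \<open>\<Omega>(log n)\<close> factors in disjoint large sets of variables, and
  for most balanced partitions every product has a factor whose variables are split unevenly, which
  makes the rank deficient.

  The polynomial \<open>f\<close> has full rank for all balanced partitions after a suitable \<open>0\<close>-\<open>1\<close> substitution
  for auxiliary selector variables. It is computed by recursion over the unions of two intervals: by
  the discrete intermediate value theorem a balanced set of this kind splits into two balanced ones,
  and after at most two steps all pieces are smaller by a constant factor. Hence the recursion
  depth is logarithmic, and each level is a sum of polynomially many products.
\<close>

text \<open>The substitution for the selectors may depend on the partition, but the products into
  which a formula decomposes may not: they are determined by the variables of its subformulas, and
  only then a partition is chosen that is bad for all of them at once. The parameters come from this
  count. With \<open>2 ^ (8 * l)\<close> main variables there are products of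
  \<open>2 * l + 1\<close> factors in at least \<open>16 ^ l\<close> variables each. A random set
  splits one of them evenly up to \<open>2 ^ l\<close> with probability at most
  \<open>2 / 2 ^ l\<close>, hence all of them with probability about
  \<open>1 / 2 ^ (2 * l * l)\<close>, while passing to exactly balanced sets costs only a factor
  \<open>2 ^ (8 * l)\<close>. So either there are very many products, or for some balanced set every
  product loses a factor \<open>2 ^ 2 ^ l\<close> of the rank. Both give size
  \<open>2 ^ (l * l)\<close>, where \<open>l\<close> is proportional to \<open>log N\<close>. The
  rank is that of values and not of coefficients because the defining identity of a refutation is
  only used on the cube; the passage from \<open>f\<close> to \<open>1 + 2 f\<close> changes this
  rank by at most one.\<close>

section \<open>Evaluation of polynomials, and products of multilinear polynomials\<close>

lemma peval_superset:
  assumes "finite M" "Poly_Mapping.keys p \<subseteq> M"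
  shows "peval p a =
    (\<Sum>m\<in>M. Poly_Mapping.lookup p m * (\<Prod>i\<in>Poly_Mapping.keys m. a i ^ Poly_Mapping.lookup m i))"
  unfolding peval_def using assms
  by (intro sum.mono_neutral_left) (auto simp: in_keys_iff)

lemma peval_add: "peval (p + q) a = peval p a + peval q a"
proof -
  let ?M = "Poly_Mapping.keys p \<union> Poly_Mapping.keys q"
  have k: "Poly_Mapping.keys (p + q) \<subseteq> ?M" by (rule keys_add)
  show ?thesis
    unfolding peval_superset[OF _ k, simplified] peval_superset[of ?M p, simplified]
      peval_superset[of ?M q, simplified]
    by (simp add: lookup_add algebra_simps sum.distrib)
qed

lemma peval_0 [simp]: "peval 0 a = 0"
  by (simp add: peval_def)

lemma peval_sum: "peval (sum f I) a = (\<Sum>i\<in>I. peval (f i) a)"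
  by (induction I rule: infinite_finite_induct) (auto simp: peval_add)

lemma peval_diff: "peval (p - q) a = peval p a - peval q a"
  using peval_add[of "p - q" q a] by simp

lemma peval_single:
  "peval (Poly_Mapping.single m c) a = c * (\<Prod>i\<in>Poly_Mapping.keys m. a i ^ Poly_Mapping.lookup m i)"
  by (cases "c = 0") (auto simp: peval_def)

lemma peval_pconst [simp]: "peval (pconst c) a = c"
  by (simp add: pconst_def peval_single)

lemma peval_1 [simp]: "peval 1 a = 1"
  by (metis pconst_def peval_pconst single_one)

lemma peval_Xv [simp]: "peval (Xv i) a = a i"
  by (simp add: Xv_def peval_single)

lemma monom_eval_add:
  fixes a :: "nat \<Rightarrow> 'a::comm_ring_1"
  shows "(\<Prod>i\<in>Poly_Mapping.keys (m + m'). a i ^ Poly_Mapping.lookup (m + m') i) =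
    (\<Prod>i\<in>Poly_Mapping.keys m. a i ^ Poly_Mapping.lookup m i) *
    (\<Prod>i\<in>Poly_Mapping.keys m'. a i ^ Poly_Mapping.lookup m' i)"
proof -
  let ?K = "Poly_Mapping.keys m \<union> Poly_Mapping.keys m'"
  have *: "(\<Prod>i\<in>Poly_Mapping.keys x. a i ^ Poly_Mapping.lookup x i) =
      (\<Prod>i\<in>?K. a i ^ Poly_Mapping.lookup x i)" if "Poly_Mapping.keys x \<subseteq> ?K" for x
    using that by (intro prod.mono_neutral_left) (auto simp: in_keys_iff)
  have "Poly_Mapping.keys (m + m') \<subseteq> ?K" by (rule keys_add)
  from *[OF this] *[OF Un_upper1] *[OF Un_upper2] show ?thesis
    by (simp only: lookup_add power_add prod.distrib)
qed

lemma sum_single_keys: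
  "p = (\<Sum>m\<in>Poly_Mapping.keys p. Poly_Mapping.single m (Poly_Mapping.lookup p m))"
  by (intro poly_mapping_eqI)
    (auto simp: lookup_sum lookup_single when_def in_keys_iff)

lemma peval_mult: "peval (p * q) a = peval p a * peval q a"
proof -
  let ?s = "\<lambda>p. \<lambda>m. Poly_Mapping.single m (Poly_Mapping.lookup p m)"
  have "p * q = (\<Sum>m\<in>Poly_Mapping.keys p. \<Sum>m'\<in>Poly_Mapping.keys q. ?s p m * ?s q m')"
    by (subst sum_single_keys[of p], subst sum_single_keys[of q]) (rule sum_product)
  then have "peval (p * q) a =
      (\<Sum>m\<in>Poly_Mapping.keys p. \<Sum>m'\<in>Poly_Mapping.keys q. peval (?s p m) a * peval (?s q m') a)"
    by (simp add: peval_sum mult_single peval_single monom_eval_add mult_ac)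
  then show ?thesis
    by (simp add: peval_def[of p] peval_def[of q] peval_single sum_product)
qed

lemma peval_cong_pvars:
  assumes "\<And>i. i \<in> pvars p \<Longrightarrow> a i = b i"
  shows "peval p a = peval p b"
  unfolding peval_def
proof (intro sum.cong refl arg_cong2[of _ _ _ _ "(*)"] prod.cong)
  fix m i assume "m \<in> Poly_Mapping.keys p" "i \<in> Poly_Mapping.keys m"
  then have "i \<in> pvars p" by (auto simp: pvars_def)
  then show "a i ^ Poly_Mapping.lookup m i = b i ^ Poly_Mapping.lookup m i"
    by (simp add: assms)
qed

lemma multilinearD: "multilinear p \<Longrightarrow> m \<in> Poly_Mapping.keys p \<Longrightarrow> Poly_Mapping.lookup m i \<le> 1"
  by (simp add: multilinear_def)

text \<open>If both factors contained a variable \<open>i\<close>, their parts linear in it would be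
  nonzero. Over an integral domain so is the product of these parts, and it contributes monomials of
  degree 2 in \<open>i\<close> that nothing cancels.\<close>

lemma pvars_mult_disjoint:
  fixes p q :: "'a::idom mpoly"
  assumes ml: "multilinear (p * q)" "multilinear p" "multilinear q"
  shows "pvars p \<inter> pvars q = {}"
proof (rule ccontr)
  assume "pvars p \<inter> pvars q \<noteq> {}"
  then obtain i where i: "i \<in> pvars p" "i \<in> pvars q" by auto
  define top :: "'a mpoly \<Rightarrow> 'a mpoly"
    where "top p = (\<Sum>m\<in>{m \<in> Poly_Mapping.keys p. Poly_Mapping.lookup m i = 1}.
      Poly_Mapping.single m (Poly_Mapping.lookup p m))" for p
  have lt: "Poly_Mapping.lookup (top p) m = (if Poly_Mapping.lookup m i = 1 then Poly_Mapping.lookup p m else 0)"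
    for p m
    by (auto simp: top_def lookup_sum lookup_single when_def in_keys_iff)
  have nz: "top p \<noteq> 0" if p: "i \<in> pvars p" "multilinear p" for p
  proof -
    obtain m where m: "m \<in> Poly_Mapping.keys p" "i \<in> Poly_Mapping.keys m"
      using p unfolding pvars_def by blast
    then have "Poly_Mapping.lookup m i = 1"
      using multilinearD[OF p(2) m(1), of i] by (simp add: in_keys_iff)
    then have "Poly_Mapping.lookup (top p) m \<noteq> 0"
      using m by (simp add: lt in_keys_iff)
    then show ?thesis by auto
  qed
  have kt: "Poly_Mapping.lookup m i = 1" if "m \<in> Poly_Mapping.keys (top p)" for m p
    using that by (auto simp: in_keys_iff lt split: if_splits)
  have kr: "Poly_Mapping.lookup m i = 0" if "m \<in> Poly_Mapping.keys (p - top p)" "multilinear p" for m p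
  proof -
    have "Poly_Mapping.lookup m i \<noteq> 1" "m \<in> Poly_Mapping.keys p"
      using that(1) by (auto simp: in_keys_iff lookup_minus lt split: if_splits)
    then show ?thesis
      using multilinearD[OF that(2), of m i] by linarith
  qed
  have "top p * top q \<noteq> 0" using nz i ml by simp
  then obtain m where m: "m \<in> Poly_Mapping.keys (top p * top q)"
    by (metis all_not_in_conv keys_eq_empty)
  then obtain x y where xy: "m = x + y" "x \<in> Poly_Mapping.keys (top p)" "y \<in> Poly_Mapping.keys (top q)"
    using keys_mult[of "top p" "top q"] by blast
  then have deg: "Poly_Mapping.lookup m i = 2"
    using kt[OF xy(2)] kt[OF xy(3)] by (simp add: lookup_add)
  have low: "Poly_Mapping.lookup (u * v) m = 0"
    if "\<And>m. m \<in> Poly_Mapping.keys u \<Longrightarrow> Poly_Mapping.lookup m i \<le> 1"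
      "\<And>m. m \<in> Poly_Mapping.keys v \<Longrightarrow> Poly_Mapping.lookup m i = 0" for u v :: "'a mpoly"
  proof (rule ccontr)
    assume "Poly_Mapping.lookup (u * v) m \<noteq> 0"
    then obtain x y where xy: "m = x + y" "x \<in> Poly_Mapping.keys u" "y \<in> Poly_Mapping.keys v"
      using keys_mult[of u v] by (auto simp: in_keys_iff)
    then show False using that(1)[OF xy(2)] that(2)[OF xy(3)] deg by (simp add: lookup_add)
  qed
  \<comment> \<open>Each of the two correction terms has a factor free of \<open>i\<close>, so it
    has no monomial of degree 2 in \<open>i\<close>.\<close>
  have eq: "p * q = top p * top q + (p * (q - top q) + top q * (p - top p))"
    by (simp add: algebra_simps)
  have "Poly_Mapping.lookup (p * (q - top q)) m = 0"
    using ml kr by (intro low) (auto simp: multilinear_def)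
  moreover have "Poly_Mapping.lookup (top q * (p - top p)) m = 0"
    using ml kr kt by (intro low) auto
  ultimately have "Poly_Mapping.lookup (p * q) m = Poly_Mapping.lookup (top p * top q) m"
    by (subst eq) (simp add: lookup_add)
  then have "m \<in> Poly_Mapping.keys (p * q)" using m by (simp add: in_keys_iff)
  then show False using multilinearD[OF ml(1), of m i] deg by simp
qed

section \<open>Evaluation of formulas, and syntactic against semantic multilinearity\<close>

primrec teval :: "'a::comm_ring_1 aterm \<Rightarrow> (nat \<Rightarrow> 'a) \<Rightarrow> 'a" where
  "teval (AVar i) a = a i"
| "teval (AConst c) a = c"
| "teval (AAdd s t) a = teval s a + teval t a"
| "teval (AMul s t) a = teval s a * teval t a"

lemma peval_ev: "peval (ev t) a = teval t a"
  by (induction t) (auto simp: peval_add peval_mult)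

lemma teval_cong: "(\<And>i. i \<in> tvars t \<Longrightarrow> a i = b i) \<Longrightarrow> teval t a = teval t b"
  by (induction t) auto

lemma finite_subterms [simp]: "finite (subterms t)"
  by (induction t) auto

lemma self_in_subterms [simp]: "t \<in> subterms t"
  by (cases t) auto

lemma finite_tvars [simp]: "finite (tvars t)"
  by (induction t) auto

lemma syntactically_multilinear_simps [simp]:
  "syntactically_multilinear (AVar i)"
  "syntactically_multilinear (AConst c)"
  "syntactically_multilinear (AAdd s t) \<longleftrightarrow> syntactically_multilinear s \<and> syntactically_multilinear t"
  "syntactically_multilinear (AMul s t) \<longleftrightarrow>
     syntactically_multilinear s \<and> syntactically_multilinear t \<and> tvars s \<inter> tvars t = {}"
  unfolding syntactically_multilinear_def by simp_all (rule iffI; blast)+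

lemma pvars_add: "pvars (p + q) \<subseteq> pvars p \<union> pvars q"
  using keys_add[of p q] by (auto simp: pvars_def)

lemma pvars_mult: "pvars (p * q) \<subseteq> pvars p \<union> pvars q"
  using keys_mult[of p q] keys_add by (fastforce simp: pvars_def)

lemma pvars_ev: "pvars (ev t) \<subseteq> tvars t"
proof (induction t)
  case (AAdd s t)
  then show ?case using pvars_add[of "ev s" "ev t"] by auto
next
  case (AMul s t)
  then show ?case using pvars_mult[of "ev s" "ev t"] by auto
qed (auto simp: pvars_def Xv_def pconst_def split: if_splits)

lemma multilinear_ev: "syntactically_multilinear t \<Longrightarrow> multilinear (ev t)"
proof (induction t)
  case (AAdd s t)
  then show ?case using keys_add[of "ev s" "ev t"] by (auto simp: multilinear_def)
next
  case (AMul s t)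
  then have disj: "pvars (ev s) \<inter> pvars (ev t) = {}"
    using pvars_ev[of s] pvars_ev[of t] by fastforce
  show ?case unfolding multilinear_def
  proof (intro ballI allI)
    fix m i assume "m \<in> Poly_Mapping.keys (ev (AMul s t))"
    then obtain x y where xy: "m = x + y" "x \<in> Poly_Mapping.keys (ev s)" "y \<in> Poly_Mapping.keys (ev t)"
      using keys_mult[of "ev s" "ev t"] by auto
    then have "Poly_Mapping.lookup x i = 0 \<or> Poly_Mapping.lookup y i = 0"
      using disj unfolding pvars_def by (metis IntI UN_I empty_iff in_keys_iff)
    then show "Poly_Mapping.lookup m i \<le> 1"
      using AMul xy by (auto simp: multilinear_def lookup_add)
  qed
qed (auto simp: multilinear_def Xv_def pconst_def lookup_single when_def split: if_splits)

primrec zero_outside :: "nat set \<Rightarrow> 'a::comm_ring_1 aterm \<Rightarrow> 'a aterm" where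
  "zero_outside S (AVar i) = (if i \<in> S then AVar i else AConst 0)"
| "zero_outside S (AConst c) = AConst c"
| "zero_outside S (AAdd s t) = AAdd (zero_outside S s) (zero_outside S t)"
| "zero_outside S (AMul s t) = AMul (zero_outside S s) (zero_outside S t)"

lemma tvars_zero_outside: "tvars (zero_outside S t) = tvars t \<inter> S"
  by (induction t) auto

lemma teval_zero_outside: "teval (zero_outside S t) a = teval t (\<lambda>i. if i \<in> S then a i else 0)"
  by (induction t) auto

lemma syntactically_multilinear_zero_outside:
  "syntactically_multilinear t \<Longrightarrow> syntactically_multilinear (zero_outside S t)"
  by (induction t) (auto simp: tvars_zero_outside)

lemma fsize_zero_outside [simp]: "fsize (zero_outside S t) = fsize t"
  by (induction t) auto

lemma multilinear_formula_simps:
  "multilinear_formula (AAdd s t) \<Longrightarrow> multilinear_formula s \<and> multilinear_formula t"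
  "multilinear_formula (AMul s t) \<Longrightarrow>
    multilinear_formula s \<and> multilinear_formula t \<and> multilinear (ev s * ev t)"
  by (auto simp: multilinear_formula_def)

text \<open>
  A formula that is only semantically multilinear becomes syntactically so by setting to zero,
  at every gate, the variables on which the polynomial of that gate does not depend.
\<close>

lemma syntactically_multilinear_formula:
  fixes t :: "'a::field aterm"
  assumes "multilinear_formula t"
  obtains t' where "syntactically_multilinear t'" "tvars t' \<subseteq> pvars (ev t)" "fsize t' \<le> fsize t"
    "\<And>a. teval t' a = teval t a"
proof -
  have "\<exists>t'. syntactically_multilinear t' \<and> tvars t' \<subseteq> pvars (ev t) \<and> fsize t' \<le> fsize t \<and>
      (\<forall>a. teval t' a = teval t a)"
    using assms
  proof (induction t)
    case (AVar i)
    show ?case by (rule exI[of _ "AVar i"]) (auto simp: pvars_def Xv_def)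
  next
    case (AConst c)
    show ?case by (rule exI[of _ "AConst c"]) auto
  next
    case (AAdd s t)
    then obtain s' t' where s': "syntactically_multilinear s'" "tvars s' \<subseteq> pvars (ev s)"
        "fsize s' \<le> fsize s" "\<And>a. teval s' a = teval s a"
      and t': "syntactically_multilinear t'" "tvars t' \<subseteq> pvars (ev t)"
        "fsize t' \<le> fsize t" "\<And>a. teval t' a = teval t a"
      using multilinear_formula_simps by metis
    \<comment> \<open>Cancellation in the sum may lose variables of \<open>s'\<close> and
      \<open>t'\<close>; setting these to zero restores the invariant on
      \<open>tvars\<close>.\<close>
    let ?S = "pvars (ev (AAdd s t))"
    have "teval (zero_outside ?S (AAdd s' t')) a = teval (AAdd s t) a" for a
    proof -
      have "teval (zero_outside ?S (AAdd s' t')) a = teval (AAdd s t) (\<lambda>i. if i \<in> ?S then a i else 0)"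
        unfolding teval_zero_outside using s'(4) t'(4) by simp
      also have "\<dots> = peval (ev (AAdd s t)) (\<lambda>i. if i \<in> ?S then a i else 0)"
        by (simp only: peval_ev)
      also have "\<dots> = peval (ev (AAdd s t)) a"
        by (intro peval_cong_pvars) auto
      finally show ?thesis by (simp only: peval_ev)
    qed
    then show ?case
      using s' t' syntactically_multilinear_zero_outside[of "AAdd s' t'" ?S]
      by (intro exI[of _ "zero_outside ?S (AAdd s' t')"])
        (simp only: tvars_zero_outside fsize_zero_outside, simp)
  next
    case (AMul s t)
    then obtain s' t' where s': "syntactically_multilinear s'" "tvars s' \<subseteq> pvars (ev s)"
        "fsize s' \<le> fsize s" "\<And>a. teval s' a = teval s a"
      and t': "syntactically_multilinear t'" "tvars t' \<subseteq> pvars (ev t)"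
        "fsize t' \<le> fsize t" "\<And>a. teval t' a = teval t a"
      using multilinear_formula_simps by metis
    have ml: "multilinear (ev s * ev t)" "multilinear (ev s)" "multilinear (ev t)"
      using AMul.prems by (auto simp: multilinear_formula_def)
    \<comment> \<open>By induction the variables of \<open>s'\<close> and \<open>t'\<close> lie in
      these two sets, so the new product gate is syntactically multilinear.\<close>
    have disj: "pvars (ev s) \<inter> pvars (ev t) = {}"
      by (rule pvars_mult_disjoint[OF ml])
    let ?S = "pvars (ev (AMul s t))"
    have "teval (zero_outside ?S (AMul s' t')) a = teval (AMul s t) a" for a
    proof -
      have "teval (zero_outside ?S (AMul s' t')) a = teval (AMul s t) (\<lambda>i. if i \<in> ?S then a i else 0)"
        unfolding teval_zero_outside using s'(4) t'(4) by simp
      also have "\<dots> = peval (ev (AMul s t)) (\<lambda>i. if i \<in> ?S then a i else 0)"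
        by (simp only: peval_ev)
      also have "\<dots> = peval (ev (AMul s t)) a"
        by (intro peval_cong_pvars) auto
      finally show ?thesis by (simp only: peval_ev)
    qed
    moreover have "syntactically_multilinear (AMul s' t')" using s' t' disj by auto
    ultimately show ?case
      using s' t' syntactically_multilinear_zero_outside[of "AMul s' t'" ?S]
      by (intro exI[of _ "zero_outside ?S (AMul s' t')"])
        (simp only: tvars_zero_outside fsize_zero_outside, simp)
  qed
  then show thesis using that by blast
qed

section \<open>Rank with respect to a partition of the variables\<close>

text \<open>Stated through a factorization with \<open>r\<close> terms and not through a matrix:
  bounds for sums and products then follow by joining or pairing the index sets.\<close>

definition rk_le :: "nat set \<Rightarrow> (nat set \<Rightarrow> 'a::field) \<Rightarrow> nat \<Rightarrow> bool" where
  "rk_le Y f r \<longleftrightarrow> (\<exists>g h. \<forall>A. f A = (\<Sum>i<r. g i (A \<inter> Y) * h i (A - Y)))"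

lemma rk_leI:
  fixes I :: "'i set"
  assumes "finite I" "\<And>A. f A = (\<Sum>i\<in>I. g i (A \<inter> Y) * h i (A - Y))" "card I \<le> r"
  shows "rk_le Y f r"
proof -
  obtain e where e: "bij_betw e {..<card I} I"
    using ex_bij_betw_nat_finite[OF assms(1)] by (auto simp: atLeast0LessThan)
  let ?g = "\<lambda>i. if i < card I then g (e i) else (\<lambda>_. 0)"
  have "f A = (\<Sum>i<r. ?g i (A \<inter> Y) * h (e i) (A - Y))" for A
  proof -
    have "f A = (\<Sum>i<card I. g (e i) (A \<inter> Y) * h (e i) (A - Y))"
      unfolding assms(2) by (rule sum.reindex_bij_betw[OF e, symmetric])
    also have "\<dots> = (\<Sum>i<r. ?g i (A \<inter> Y) * h (e i) (A - Y))"
      using assms(3) by (intro sum.mono_neutral_cong_left) auto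
    finally show ?thesis .
  qed
  then show ?thesis unfolding rk_le_def by (intro exI[of _ ?g] exI[of _ "\<lambda>i. h (e i)"] allI)
qed

lemma rk_le_mono: "rk_le Y f r \<Longrightarrow> r \<le> s \<Longrightarrow> rk_le Y f s"
  unfolding rk_le_def[of _ _ r] by (elim exE, rule rk_leI[where I="{..<r}"]) auto

lemma rk_le_const: "rk_le Y (\<lambda>_. c) 1"
  by (rule rk_leI[where I="{()}" and g="\<lambda>_ _. c" and h="\<lambda>_ _. 1"]) auto

lemma rk_le_add:
  assumes "rk_le Y f r" "rk_le Y f' s"
  shows "rk_le Y (\<lambda>A. f A + f' A) (r + s)"
proof -
  obtain g h g' h' where
    "\<And>A. f A = (\<Sum>i<r. g i (A \<inter> Y) * h i (A - Y))"
    "\<And>A. f' A = (\<Sum>i<s. g' i (A \<inter> Y) * h' i (A - Y))"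
    using assms unfolding rk_le_def by metis
  then show ?thesis
    by (intro rk_leI[where I="{..<r} <+> {..<s}" and g="case_sum g g'" and h="case_sum h h'"])
      (auto simp: sum.Plus card_Plus)
qed

lemma rk_le_mult:
  assumes "rk_le Y f r" "rk_le Y f' s"
  shows "rk_le Y (\<lambda>A. f A * f' A) (r * s)"
proof -
  obtain g h g' h' where
    *: "\<And>A. f A = (\<Sum>i<r. g i (A \<inter> Y) * h i (A - Y))"
    "\<And>A. f' A = (\<Sum>i<s. g' i (A \<inter> Y) * h' i (A - Y))"
    using assms unfolding rk_le_def by metis
  have "f A * f' A = (\<Sum>(i,j)\<in>{..<r}\<times>{..<s}. (g i (A \<inter> Y) * g' j (A \<inter> Y)) * (h i (A - Y) * h' j (A - Y)))"
    for A
    unfolding * sum_product sum.cartesian_product by (simp add: mult_ac)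
  then show ?thesis
    by (intro rk_leI[where I="{..<r}\<times>{..<s}" and g="\<lambda>(i,j) A. g i A * g' j A" and h="\<lambda>(i,j) A. h i A * h' j A"])
      (auto simp: case_prod_unfold)
qed

lemma rk_le_compl: "rk_le (- Y) f r \<longleftrightarrow> rk_le Y f r"
proof -
  have "rk_le (- Y) f r" if "rk_le Y f r" for Y :: "nat set"
    using that unfolding rk_le_def
    by (elim exE) (rule exI, rule exI, auto simp: Diff_eq mult.commute)
  from this[of Y] this[of "- Y"] show ?thesis by auto
qed

text \<open>Expansion of the matrix by rows: the indicator of row \<open>B\<close> depends on
  \<open>A \<inter> Y\<close> only, the row itself on \<open>A - Y\<close> only.\<close>

lemma rk_le_vars_aux:
  assumes "finite V" "\<And>A. f A = f (A \<inter> V)"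
  shows "rk_le Y f (2 ^ card (V \<inter> Y))"
proof (rule rk_leI[where I="Pow (V \<inter> Y)" and g="\<lambda>B A. of_bool (A \<inter> V = B)" and h="\<lambda>B A. f (A \<union> B)"])
  fix A
  have "(\<Sum>B\<in>Pow (V \<inter> Y). of_bool (A \<inter> Y \<inter> V = B) * f (A - Y \<union> B)) =
    (\<Sum>B\<in>{A \<inter> Y \<inter> V}. f (A - Y \<union> B))"
    using assms(1) by (intro sum.mono_neutral_cong_right) auto
  also have "\<dots> = f (A - Y \<union> A \<inter> Y \<inter> V)" by simp
  also have "\<dots> = f A"
    by (subst (1 2) assms(2)) (rule arg_cong[of _ _ f], blast)
  finally show "f A = (\<Sum>B\<in>Pow (V \<inter> Y). of_bool (A \<inter> Y \<inter> V = B) * f (A - Y \<union> B))" by simp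
qed (use assms(1) in \<open>simp_all add: card_Pow del: Pow_Int_eq\<close>)

lemma rk_le_vars:
  assumes "finite V" "\<And>A. f A = f (A \<inter> V)"
  shows "rk_le Y f (2 ^ min (card (V \<inter> Y)) (card (V - Y)))"
  using rk_le_vars_aux[of V f Y, OF assms] rk_le_vars_aux[of V f "- Y", OF assms]
  by (auto simp: min_def rk_le_compl Diff_eq)

text \<open>Gaussian elimination: an unknown \<open>p\<close> with nonzero coefficient in the last
  equation is eliminated from the others, and its value is restored at the end.\<close>

lemma linear_dependence:
  fixes v :: "nat \<Rightarrow> 'i \<Rightarrow> 'a::field"
  assumes "finite I" "r < card I"
  shows "\<exists>c. (\<exists>i\<in>I. c i \<noteq> 0) \<and> (\<forall>k<r. (\<Sum>i\<in>I. c i * v k i) = 0)"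
  using assms
proof (induction r arbitrary: I v)
  case 0
  then obtain i where "i \<in> I" by fastforce
  then show ?case by (intro exI[of _ "\<lambda>_. 1"]) auto
next
  case (Suc r)
  show ?case
  proof (cases "\<forall>i\<in>I. v r i = 0")
    case True
    from Suc.IH[of I v] Suc.prems obtain c where
      "\<exists>i\<in>I. c i \<noteq> 0" "\<forall>k<r. (\<Sum>i\<in>I. c i * v k i) = 0" by auto
    then show ?thesis using True by (intro exI[of _ c]) (auto simp: less_Suc_eq)
  next
    case False
    then obtain p where p: "p \<in> I" "v r p \<noteq> 0" by auto
    let ?J = "I - {p}"
    have "finite ?J" "r < card ?J" using Suc.prems p by auto
    from Suc.IH[OF this, of "\<lambda>k i. v k i - v r i / v r p * v k p"] obtain c where
      c: "\<exists>i\<in>?J. c i \<noteq> 0"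
      "\<forall>k<r. (\<Sum>i\<in>?J. c i * (v k i - v r i / v r p * v k p)) = 0" by auto
    define c' where "c' = c(p := - (\<Sum>i\<in>?J. c i * v r i) / v r p)"
    have split: "(\<Sum>i\<in>I. c' i * v k i) = c' p * v k p + (\<Sum>i\<in>?J. c i * v k i)" for k
    proof -
      have "(\<Sum>i\<in>?J. c' i * v k i) = (\<Sum>i\<in>?J. c i * v k i)"
        by (intro sum.cong) (auto simp: c'_def)
      then show ?thesis using sum.remove[OF Suc.prems(1) p(1), of "\<lambda>i. c' i * v k i"] by simp
    qed
    have "(\<Sum>i\<in>I. c' i * v k i) = 0" if "k < r" for k
    proof -
      have "0 = (\<Sum>i\<in>?J. c i * v k i - c i * v r i * (v k p / v r p))"
        using c(2) that by (simp add: algebra_simps)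
      also have "\<dots> = (\<Sum>i\<in>?J. c i * v k i) - (\<Sum>i\<in>?J. c i * v r i) * (v k p / v r p)"
        by (simp only: sum_subtractf sum_distrib_right)
      finally show ?thesis unfolding split by (simp add: c'_def)
    qed
    moreover have "(\<Sum>i\<in>I. c' i * v r i) = 0"
      unfolding split using p by (simp add: c'_def)
    moreover have "\<exists>i\<in>I. c' i \<noteq> 0"
      using c(1) by (auto simp: c'_def)
    ultimately show ?thesis by (intro exI[of _ c']) (auto simp: less_Suc_eq)
  qed
qed

text \<open>
  This is stronger than full rank: the rows \<open>B\<close> and the columns \<open>\<pi> B\<close> form a diagonal submatrix
  with nonzero diagonal.
\<close>

definition full_rank :: "nat set \<Rightarrow> nat set \<Rightarrow> (nat set \<Rightarrow> 'a::zero) \<Rightarrow> bool" where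
  "full_rank Y S f \<longleftrightarrow> (\<exists>\<pi>. \<forall>B\<subseteq>S \<inter> Y. \<pi> B \<subseteq> S - Y \<and>
     (\<forall>B'\<subseteq>S \<inter> Y. f (B' \<union> \<pi> B) \<noteq> 0 \<longleftrightarrow> B' = B))"

text \<open>With too few terms, a nontrivial combination \<open>c\<close> of the rows annihilates
  every \<open>g k\<close>, hence every column of the matrix. But the column \<open>\<pi> B\<close>
  meets only the row \<open>B\<close>, which forces \<open>c B = 0\<close>.\<close>

lemma full_rank_lower_bound:
  assumes "full_rank Y S f" "rk_le Y f r" "finite S"
  shows "2 ^ card (S \<inter> Y) \<le> r"
proof (rule ccontr)
  assume less: "\<not> 2 ^ card (S \<inter> Y) \<le> r"
  obtain \<pi> where \<pi>: "\<And>B. B \<subseteq> S \<inter> Y \<Longrightarrow> \<pi> B \<subseteq> S - Y"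
    "\<And>B B'. B \<subseteq> S \<inter> Y \<Longrightarrow> B' \<subseteq> S \<inter> Y \<Longrightarrow> f (B' \<union> \<pi> B) \<noteq> 0 \<longleftrightarrow> B' = B"
    using assms(1) unfolding full_rank_def by metis
  obtain g h where gh: "\<And>A. f A = (\<Sum>i<r. g i (A \<inter> Y) * h i (A - Y))"
    using assms(2) unfolding rk_le_def by metis
  let ?I = "Pow (S \<inter> Y)"
  have "finite ?I" "r < card ?I"
    using less assms(3) by (simp_all add: card_Pow del: Pow_Int_eq)
  from linear_dependence[OF this, of g] obtain c where
    c: "\<exists>B\<in>?I. c B \<noteq> 0" "\<forall>k<r. (\<Sum>B\<in>?I. c B * g k B) = 0" by auto
  then obtain B where B: "B \<in> ?I" "c B \<noteq> 0" by auto
  have "c B * f (B \<union> \<pi> B) = (\<Sum>B'\<in>?I. c B' * f (B' \<union> \<pi> B))"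
  proof -
    have "(\<Sum>B'\<in>?I - {B}. c B' * f (B' \<union> \<pi> B)) = 0"
    proof (rule sum.neutral, rule ballI)
      fix B' assume "B' \<in> ?I - {B}"
      then have "f (B' \<union> \<pi> B) = 0" using B(1) \<pi>(2)[of B B'] by blast
      then show "c B' * f (B' \<union> \<pi> B) = 0" by simp
    qed
    then show ?thesis
      by (simp only: sum.remove[OF \<open>finite ?I\<close> B(1)] add_0_right)
  qed
  also have "\<dots> = (\<Sum>B'\<in>?I. \<Sum>k<r. c B' * g k B' * h k (\<pi> B))"
  proof (intro sum.cong refl)
    fix B' assume "B' \<in> ?I"
    then have "(B' \<union> \<pi> B) \<inter> Y = B'" "(B' \<union> \<pi> B) - Y = \<pi> B"
      using \<pi>(1)[of B] B by auto
    then show "c B' * f (B' \<union> \<pi> B) = (\<Sum>k<r. c B' * g k B' * h k (\<pi> B))"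
      by (simp add: gh sum_distrib_left mult.assoc)
  qed
  also have "\<dots> = (\<Sum>k<r. (\<Sum>B'\<in>?I. c B' * g k B') * h k (\<pi> B))"
    by (subst sum.swap) (simp add: sum_distrib_right)
  also have "\<dots> = 0" using c(2) by simp
  finally show False using B \<pi>(2)[of B B] by auto
qed

text \<open>In disjoint variables the matrix of a product is the tensor product of the two matrices,
  and diagonal matrices have a diagonal tensor product. The diagonal form of
  \<open>full_rank\<close> is chosen for this step.\<close>

lemma full_rank_mult:
  assumes "full_rank Y S f" "full_rank Y T g" "S \<inter> T = {}"
    "\<And>A. f A = f (A \<inter> S)" "\<And>A. g A = g (A \<inter> T)"
  shows "full_rank Y (S \<union> T) (\<lambda>A. f A * g A :: 'a::field)"
proof -
  obtain p where p: "\<And>B. B \<subseteq> S \<inter> Y \<Longrightarrow> p B \<subseteq> S - Y"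
    "\<And>B B'. B \<subseteq> S \<inter> Y \<Longrightarrow> B' \<subseteq> S \<inter> Y \<Longrightarrow> f (B' \<union> p B) \<noteq> 0 \<longleftrightarrow> B' = B"
    using assms(1) unfolding full_rank_def by metis
  obtain q where q: "\<And>B. B \<subseteq> T \<inter> Y \<Longrightarrow> q B \<subseteq> T - Y"
    "\<And>B B'. B \<subseteq> T \<inter> Y \<Longrightarrow> B' \<subseteq> T \<inter> Y \<Longrightarrow> g (B' \<union> q B) \<noteq> 0 \<longleftrightarrow> B' = B"
    using assms(2) unfolding full_rank_def by metis
  show ?thesis
    unfolding full_rank_def
  proof (intro exI[of _ "\<lambda>B. p (B \<inter> S) \<union> q (B \<inter> T)"] allI impI conjI)
    fix B assume B: "B \<subseteq> (S \<union> T) \<inter> Y"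
    have s: "p (B \<inter> S) \<subseteq> S - Y" "q (B \<inter> T) \<subseteq> T - Y" using B by (auto intro!: p q dest!: subsetD)
    then show "p (B \<inter> S) \<union> q (B \<inter> T) \<subseteq> S \<union> T - Y" by auto
    fix B' assume B': "B' \<subseteq> (S \<union> T) \<inter> Y"
    have "(B' \<union> (p (B \<inter> S) \<union> q (B \<inter> T))) \<inter> S = B' \<inter> S \<union> p (B \<inter> S)"
      "(B' \<union> (p (B \<inter> S) \<union> q (B \<inter> T))) \<inter> T = B' \<inter> T \<union> q (B \<inter> T)"
      using s assms(3) by auto
    then have "f (B' \<union> (p (B \<inter> S) \<union> q (B \<inter> T))) = f (B' \<inter> S \<union> p (B \<inter> S))"
      "g (B' \<union> (p (B \<inter> S) \<union> q (B \<inter> T))) = g (B' \<inter> T \<union> q (B \<inter> T))"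
      using assms(4)[of "B' \<union> (p (B \<inter> S) \<union> q (B \<inter> T))"] assms(5)[of "B' \<union> (p (B \<inter> S) \<union> q (B \<inter> T))"]
      by simp_all
    moreover have "f (B' \<inter> S \<union> p (B \<inter> S)) \<noteq> 0 \<longleftrightarrow> B' \<inter> S = B \<inter> S"
      by (rule p(2)) (use B B' in auto)
    moreover have "g (B' \<inter> T \<union> q (B \<inter> T)) \<noteq> 0 \<longleftrightarrow> B' \<inter> T = B \<inter> T"
      by (rule q(2)) (use B B' in auto)
    moreover have "B' = B \<longleftrightarrow> B' \<inter> S = B \<inter> S \<and> B' \<inter> T = B \<inter> T"
      using B B' by blast
    ultimately show "f (B' \<union> (p (B \<inter> S) \<union> q (B \<inter> T))) * g (B' \<union> (p (B \<inter> S) \<union> q (B \<inter> T))) \<noteq> 0 \<longleftrightarrow> B' = B"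
      by simp
  qed
qed

text \<open>The rows \<open>{}\<close>, \<open>{i}\<close> and the columns \<open>{j}\<close>,
  \<open>{}\<close> form a diagonal matrix. The lemma serves the difference of two
  variables.\<close>

lemma full_rank_pair:
  fixes f :: "nat set \<Rightarrow> 'a::field"
  assumes "i \<in> Y" "j \<notin> Y" "\<And>A. f A \<noteq> 0 \<longleftrightarrow> (i \<in> A \<longleftrightarrow> j \<notin> A)"
  shows "full_rank Y {i, j} f"
proof -
  have *: "B = {} \<or> B = {i}" if "B \<subseteq> {i, j} \<inter> Y" for B
    using that assms by auto
  show ?thesis
    unfolding full_rank_def assms(3)
  proof (intro exI[of _ "\<lambda>B. if i \<in> B then {} else {j}"] allI impI conjI)
    fix B B' assume "B \<subseteq> {i, j} \<inter> Y" "B' \<subseteq> {i, j} \<inter> Y"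
    then show "(i \<in> B' \<union> (if i \<in> B then {} else {j}) \<longleftrightarrow> j \<notin> B' \<union> (if i \<in> B then {} else {j})) \<longleftrightarrow> B' = B"
      using *[of B] *[of B'] assms by auto
  qed (use assms in auto)
qed

section \<open>Decomposition of multilinear formulas\<close>

text \<open>Constants do not count, so replacing a subformula that contains a variable by
  \<open>AConst 0\<close> lowers this measure, on which the decomposition recurses.\<close>

primrec var_leaves :: "'a aterm \<Rightarrow> nat" where
  "var_leaves (AVar i) = 1"
| "var_leaves (AConst c) = 0"
| "var_leaves (AAdd s t) = var_leaves s + var_leaves t"
| "var_leaves (AMul s t) = var_leaves s + var_leaves t"

lemma var_leaves_le_fsize: "var_leaves t \<le> fsize t"
  by (induction t) auto

lemma tvars_no_leaves: "var_leaves t = 0 \<Longrightarrow> tvars t = {}"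
  by (induction t) auto

text \<open>What is meant: \<open>u\<close> is a subformula of \<open>t\<close>, \<open>r\<close> is
  \<open>t\<close> with \<open>u\<close> replaced by zero, and \<open>g\<close> is the product of
  the siblings at the product gates above \<open>u\<close>, which share no variables with
  \<open>u\<close>. It is kept as a function since only its values and its variables matter.\<close>

definition splits :: "'a::comm_ring_1 aterm \<Rightarrow> 'a aterm \<Rightarrow> 'a aterm \<Rightarrow> ((nat \<Rightarrow> 'a) \<Rightarrow> 'a) \<Rightarrow> bool" where
  "splits t u r g \<longleftrightarrow> syntactically_multilinear u \<and> syntactically_multilinear r \<and>
     tvars u \<subseteq> tvars t \<and> tvars r \<subseteq> tvars t \<and> var_leaves r + var_leaves u \<le> var_leaves t \<and>
     (\<forall>a. teval t a = g a * teval u a + teval r a) \<and>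
     (\<forall>a b. (\<forall>i\<in>tvars t - tvars u. a i = b i) \<longrightarrow> g a = g b)"

lemma splits_refl: "syntactically_multilinear t \<Longrightarrow> splits t t (AConst 0) (\<lambda>_. 1)"
  by (auto simp: splits_def)

lemma splits_AAdd:
  assumes "splits s u r g" "syntactically_multilinear t"
  shows "splits (AAdd s t) u (AAdd r t) g" "splits (AAdd t s) u (AAdd t r) g"
  using assms by (auto simp: splits_def)

lemma splits_AMul:
  assumes "splits s u r g" "syntactically_multilinear t" "tvars s \<inter> tvars t = {}"
  shows "splits (AMul s t) u (AMul r t) (\<lambda>a. g a * teval t a)"
    "splits (AMul t s) u (AMul t r) (\<lambda>a. g a * teval t a)"
proof -
  have *: "g a * teval t a = g b * teval t b"
    if "\<forall>i\<in>tvars s \<union> tvars t - tvars u. a i = b i" for a b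
  proof (rule arg_cong2[of _ _ _ _ "(*)"])
    show "g a = g b" using assms(1) that unfolding splits_def by blast
    have "tvars t \<inter> tvars u = {}" using assms unfolding splits_def by blast
    then show "teval t a = teval t b" using that by (intro teval_cong) auto
  qed
  show "splits (AMul s t) u (AMul r t) (\<lambda>a. g a * teval t a)"
    "splits (AMul t s) u (AMul t r) (\<lambda>a. g a * teval t a)"
    using assms * unfolding splits_def by (auto simp: algebra_simps Un_commute)
qed

text \<open>Descend from the root, always to a child with more than a third of \<open>m\<close>
  variables in \<open>X\<close>. There is one as long as the gate has more than two thirds, and
  \<open>3 \<le> m\<close> keeps the descent away from the leaves.\<close>

lemma exists_split:
  assumes "syntactically_multilinear t" "finite X" "3 \<le> m" "m < 3 * card (tvars t \<inter> X)"
  shows "\<exists>u r g. splits t u r g \<and> m < 3 * card (tvars u \<inter> X) \<and> 3 * card (tvars u \<inter> X) \<le> 2 * m"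
  using assms(1,4)
proof (induction t)
  case (AVar i)
  have "card ({i} \<inter> X) \<le> 1"
    using card_mono[of "{i}" "{i} \<inter> X"] by auto
  moreover have "m < 3 * card ({i} \<inter> X)" using AVar.prems(2) by simp
  ultimately have False using assms(3) by linarith
  then show ?case ..
next
  case (AConst c)
  then show ?case by simp
next
  case (AAdd s t)
  show ?case
  proof (cases "3 * card (tvars (AAdd s t) \<inter> X) \<le> 2 * m")
    case True
    then show ?thesis using AAdd.prems splits_refl by blast
  next
    case False
    have "card (tvars (AAdd s t) \<inter> X) \<le> card (tvars s \<inter> X) + card (tvars t \<inter> X)"
      by (simp add: Int_Un_distrib2 card_Un_le)
    then have "m < 3 * card (tvars s \<inter> X) \<or> m < 3 * card (tvars t \<inter> X)" using False by linarith
    then show ?thesis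
    proof
      assume "m < 3 * card (tvars s \<inter> X)"
      then obtain u r g where "splits s u r g" "m < 3 * card (tvars u \<inter> X)"
          "3 * card (tvars u \<inter> X) \<le> 2 * m"
        using AAdd by auto
      then show ?thesis using splits_AAdd(1)[of s u r g t] AAdd.prems by auto
    next
      assume "m < 3 * card (tvars t \<inter> X)"
      then obtain u r g where "splits t u r g" "m < 3 * card (tvars u \<inter> X)"
          "3 * card (tvars u \<inter> X) \<le> 2 * m"
        using AAdd by auto
      then show ?thesis using splits_AAdd(2)[of t u r g s] AAdd.prems by auto
    qed
  qed
next
  case (AMul s t)
  show ?case
  proof (cases "3 * card (tvars (AMul s t) \<inter> X) \<le> 2 * m")
    case True
    then show ?thesis using AMul.prems splits_refl by blast
  next
    case False
    have disj: "tvars s \<inter> tvars t = {}" "tvars t \<inter> tvars s = {}"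
      using AMul.prems by auto
    have "card (tvars (AMul s t) \<inter> X) \<le> card (tvars s \<inter> X) + card (tvars t \<inter> X)"
      by (simp add: Int_Un_distrib2 card_Un_le)
    then have "m < 3 * card (tvars s \<inter> X) \<or> m < 3 * card (tvars t \<inter> X)" using False by linarith
    then show ?thesis
    proof
      assume "m < 3 * card (tvars s \<inter> X)"
      then obtain u r g where "splits s u r g" "m < 3 * card (tvars u \<inter> X)"
          "3 * card (tvars u \<inter> X) \<le> 2 * m"
        using AMul by auto
      then show ?thesis using splits_AMul(1)[of s u r g t] AMul.prems disj by auto
    next
      assume "m < 3 * card (tvars t \<inter> X)"
      then obtain u r g where "splits t u r g" "m < 3 * card (tvars u \<inter> X)"
          "3 * card (tvars u \<inter> X) \<le> 2 * m"
        using AMul by auto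
      then show ?thesis using splits_AMul(2)[of t u r g s] AMul.prems disj by auto
    qed
  qed
qed

primrec parts :: "nat set list \<Rightarrow> nat set \<Rightarrow> bool" where
  "parts [] V \<longleftrightarrow> V = {}"
| "parts (S # T) V \<longleftrightarrow> S \<subseteq> V \<and> parts T (V - S)"

definition smaller_side :: "nat set \<Rightarrow> nat set \<Rightarrow> nat" where
  "smaller_side Y S = min (card (S \<inter> Y)) (card (S - Y))"

text \<open>The rank bound for a product with one factor in the variables of each set of the
  list.\<close>

definition tuple_bound :: "nat set \<Rightarrow> nat set list \<Rightarrow> nat" where
  "tuple_bound Y T = prod_list (map (\<lambda>S. 2 ^ smaller_side Y S) T)"

lemma tuple_bound_simps [simp]:
  "tuple_bound Y [] = 1"
  "tuple_bound Y (S # T) = 2 ^ smaller_side Y S * tuple_bound Y T"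
  by (simp_all add: tuple_bound_def)

text \<open>Only the variables in \<open>X\<close> are free; the others are frozen to the indicator
  of \<open>U\<close>, which is how selectors are switched on.\<close>

definition bool_fun :: "nat set \<Rightarrow> nat set \<Rightarrow> 'a::comm_ring_1 aterm \<Rightarrow> nat set \<Rightarrow> 'a" where
  "bool_fun X U t A = teval t (\<lambda>i. of_bool (i \<in> A \<inter> X \<union> U))"

lemma bool_fun_vars: "tvars t \<inter> X \<subseteq> V \<Longrightarrow> bool_fun X U t A = bool_fun X U t (A \<inter> V)"
  unfolding bool_fun_def by (intro teval_cong arg_cong[of _ _ of_bool]) auto

definition decomposed :: "nat \<Rightarrow> nat \<Rightarrow> nat set \<Rightarrow> nat set list list \<Rightarrow> bool" where
  "decomposed b t V TT \<longleftrightarrow> (\<forall>T\<in>set TT. length T = Suc t \<and> parts T V \<and> (\<forall>S\<in>set T. b \<le> card S))"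

lemma decomposed_append:
  "decomposed b t V (TT @ TT') \<longleftrightarrow> decomposed b t V TT \<and> decomposed b t V TT'"
  by (auto simp: decomposed_def)

lemma decomposed_map_Cons:
  assumes "decomposed b t (V - S) TT" "S \<subseteq> V" "b \<le> card S"
  shows "decomposed b (Suc t) V (map ((#) S) TT)"
  using assms by (auto simp: decomposed_def)

lemma sum_tuple_bound_map_Cons:
  "(\<Sum>T\<leftarrow>map ((#) S) TT. tuple_bound Y T) = 2 ^ smaller_side Y S * (\<Sum>T\<leftarrow>TT. tuple_bound Y T)"
  by (induction TT) (auto simp: algebra_simps)

text \<open>Write the formula as \<open>g * u + r\<close>, where \<open>u\<close> has between one
  and two thirds of the variables. The remaining variables form a block that carries
  \<open>g\<close>, \<open>u\<close> is decomposed with one level less, and \<open>r\<close>, which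
  has fewer leaves, with the same number of levels. Each level costs a factor 3 in size.
  \<open>TT\<close> is quantified before \<open>Y\<close> and \<open>U\<close> because the later
  count needs one list for all partitions.\<close>

lemma formula_decomposition:
  fixes \<Phi> :: "'a::field aterm"
  assumes "finite X" "1 \<le> b" "syntactically_multilinear \<Phi>"
    "tvars \<Phi> \<inter> X \<subseteq> V" "V \<subseteq> X" "3 ^ t * b \<le> card V"
  shows "\<exists>TT. length TT \<le> 1 + t * var_leaves \<Phi> \<and> decomposed b t V TT \<and>
    (\<forall>Y U. rk_le Y (bool_fun X U \<Phi>) (\<Sum>T\<leftarrow>TT. tuple_bound Y T))"
  using assms(3-6)
proof (induction t arbitrary: V \<Phi>)
  case 0
  have "finite V" using 0 assms(1) finite_subset by blast
  have "rk_le Y (bool_fun X U \<Phi>) (2 ^ smaller_side Y V)" for Y U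
    unfolding smaller_side_def
    using rk_le_vars[of V "bool_fun X U \<Phi>", OF \<open>finite V\<close> bool_fun_vars[OF 0(2)]] .
  then show ?case
    using 0 by (intro exI[of _ "[[V]]"]) (auto simp: decomposed_def)
next
  case (Suc t)
  note IHt = Suc.IH
  from Suc.prems show ?case
  proof (induction "var_leaves \<Phi>" arbitrary: \<Phi> rule: less_induct)
    case less
    let ?v = "tvars \<Phi> \<inter> X"
    have finV: "finite V" using less assms(1) finite_subset by blast
    have pb: "b \<le> 3 ^ t * b" by simp
    have cV: "3 * (3 ^ t * b) \<le> card V" using less.prems(4) by simp
    show ?case
    proof (cases "3 * card ?v \<le> 2 * card V")
      case True
      have "card (V - ?v) = card V - card ?v"
        using less.prems(2) finV by (intro card_Diff_subset) (auto intro: finite_subset)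
      then have "card V div 3 \<le> card (V - ?v)" using True by linarith
      \<comment> \<open>The formula misses a third of \<open>V\<close>, which is set aside as a
        block without influence. Taking exactly \<open>card V div 3\<close> elements leaves enough
        for the other levels.\<close>
      then obtain R where R: "R \<subseteq> V - ?v" "card R = card V div 3" "finite R"
        by (rule obtain_subset_with_card_n)
      have "card (V - R) = card V - card V div 3"
        using R by (subst card_Diff_subset) auto
      then have c: "3 ^ t * b \<le> card (V - R)" using cV by linarith
      have "tvars \<Phi> \<inter> X \<subseteq> V - R" "V - R \<subseteq> X" using R less.prems by auto
      from IHt[OF less.prems(1) this c] obtain TT where TT:
        "length TT \<le> 1 + t * var_leaves \<Phi>" "decomposed b t (V - R) TT"
        "\<And>Y U. rk_le Y (bool_fun X U \<Phi>) (\<Sum>T\<leftarrow>TT. tuple_bound Y T)" by blast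
      have "rk_le Y (bool_fun X U \<Phi>) (\<Sum>T\<leftarrow>map ((#) R) TT. tuple_bound Y T)" for Y U
        by (rule rk_le_mono[OF TT(3)]) (simp only: sum_tuple_bound_map_Cons, simp)
      moreover have "decomposed b (Suc t) V (map ((#) R) TT)"
      proof (rule decomposed_map_Cons[OF TT(2)])
        show "b \<le> card R" using cV pb R(2) by linarith
      qed (use R in auto)
      ultimately show ?thesis
        using TT(1) by (intro exI[of _ "map ((#) R) TT"]) auto
    next
      case False
      have "3 \<le> card V" using cV pb assms(2) by linarith
      moreover have "card V < 3 * card ?v" using False by linarith
      ultimately obtain u r g where u: "splits \<Phi> u r g" "card V < 3 * card (tvars u \<inter> X)"
          "3 * card (tvars u \<inter> X) \<le> 2 * card V"
        using exists_split[OF less.prems(1) assms(1)] by blast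
      let ?u = "tvars u \<inter> X"
      have sub: "?u \<subseteq> V" "tvars r \<inter> X \<subseteq> V" using u(1) less.prems unfolding splits_def by auto
      have "tvars u \<noteq> {}" using u(2) by auto
      then have pos: "0 < var_leaves u" using tvars_no_leaves by auto
      have vl: "var_leaves r + var_leaves u \<le> var_leaves \<Phi>" using u(1) by (simp add: splits_def)
      have sm: "syntactically_multilinear u" "syntactically_multilinear r"
        using u(1) by (auto simp: splits_def)
      have "var_leaves r < var_leaves \<Phi>" using pos vl by linarith
      from less.hyps[OF this sm(2) sub(2) less.prems(3,4)] obtain TT where TT:
        "length TT \<le> 1 + Suc t * var_leaves r" "decomposed b (Suc t) V TT"
        "\<And>Y U. rk_le Y (bool_fun X U r) (\<Sum>T\<leftarrow>TT. tuple_bound Y T)" by blast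
      have "3 ^ t * b \<le> card ?u" using u(2) cV by linarith
      from IHt[OF sm(1) _ _ this] obtain TT' where TT':
        "length TT' \<le> 1 + t * var_leaves u" "decomposed b t ?u TT'"
        "\<And>Y U. rk_le Y (bool_fun X U u) (\<Sum>T\<leftarrow>TT'. tuple_bound Y T)" by blast
      let ?S = "V - ?u"
      let ?TT = "TT @ map ((#) ?S) TT'"
      have "card ?S = card V - card ?u"
        using sub(1) finV by (intro card_Diff_subset) (auto intro: finite_subset)
      then have "b \<le> card ?S" using u(3) cV pb by linarith
      moreover have "V - ?S = ?u" using sub(1) by auto
      ultimately have dec: "decomposed b (Suc t) V ?TT"
        unfolding decomposed_append using TT(2) TT'(2) by (auto intro!: decomposed_map_Cons)
      \<comment> \<open>The additional 1 from the second list is paid for by a variable leaf of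
        \<open>u\<close>.\<close>
      have "length ?TT \<le> 1 + Suc t * var_leaves \<Phi>"
      proof -
        have "length ?TT \<le> 2 + Suc t * var_leaves r + t * var_leaves u"
          using TT(1) TT'(1) by simp
        also have "\<dots> \<le> 1 + Suc t * (var_leaves r + var_leaves u)"
          using pos by (simp add: algebra_simps)
        also have "\<dots> \<le> 1 + Suc t * var_leaves \<Phi>" using vl by (intro add_left_mono mult_left_mono) auto
        finally show ?thesis .
      qed
      moreover have "rk_le Y (bool_fun X U \<Phi>) (\<Sum>T\<leftarrow>?TT. tuple_bound Y T)" for Y U
      proof -
        define gg where "gg = (\<lambda>A. g (\<lambda>i. of_bool (i \<in> A \<inter> X \<union> U)))"
        have gd: "g a = g b" if "\<And>i. i \<in> tvars \<Phi> - tvars u \<Longrightarrow> a i = b i" for a b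
          using u(1) that by (simp add: splits_def)
        have "gg A = gg (A \<inter> ?S)" for A
          unfolding gg_def
        proof (rule gd)
          fix i assume "i \<in> tvars \<Phi> - tvars u"
          then have "i \<in> A \<inter> X \<union> U \<longleftrightarrow> i \<in> A \<inter> ?S \<inter> X \<union> U" using less.prems by auto
          then show "of_bool (i \<in> A \<inter> X \<union> U) = (of_bool (i \<in> A \<inter> ?S \<inter> X \<union> U) :: 'a)" by simp
        qed
        then have 1: "rk_le Y gg (2 ^ smaller_side Y ?S)"
          unfolding smaller_side_def using finV by (intro rk_le_vars) auto
        have "bool_fun X U \<Phi> = (\<lambda>A. bool_fun X U r A + gg A * bool_fun X U u A)"
          using u(1) by (auto simp: splits_def bool_fun_def gg_def)
        moreover have "rk_le Y \<dots> ((\<Sum>T\<leftarrow>TT. tuple_bound Y T) +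
            2 ^ smaller_side Y ?S * (\<Sum>T\<leftarrow>TT'. tuple_bound Y T))"
          by (intro rk_le_add rk_le_mult 1 TT TT')
        ultimately show ?thesis
          by (simp only: map_append sum_list_append sum_tuple_bound_map_Cons)
      qed
      ultimately show ?thesis using dec by blast
    qed
  qed
qed

section \<open>Counting nearly balanced partitions\<close>

lemma central_binomial_Suc:
  "Suc k * (2 * Suc k choose Suc k) = 2 * (2 * k + 1) * (2 * k choose k)"
proof -
  have "Suc k * (Suc (2 * k + 1) choose Suc k) = Suc (2 * k + 1) * (2 * k + 1 choose k)"
    by (rule Suc_times_binomial)
  moreover have "Suc k * (Suc (2 * k) choose Suc k) = Suc (2 * k) * (2 * k choose k)"
    by (rule Suc_times_binomial)
  moreover have "2 * k + 1 choose k = Suc (2 * k) choose Suc k"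
    using binomial_symmetric[of k "2 * k + 1"] by simp
  ultimately have "Suc k * (2 * Suc k choose Suc k) = 2 * (Suc k * (Suc (2 * k) choose Suc k))"
    by (simp add: algebra_simps)
  also have "\<dots> = 2 * (2 * k + 1) * (2 * k choose k)"
    by (subst Suc_times_binomial) simp
  finally show ?thesis .
qed

text \<open>The induction step multiplies the left side by
  \<open>4 * (2 * k + 1) * (2 * k + 3) / (k + 1) ^ 2\<close>, which is below 16 since
  \<open>(2 * k + 1) * (2 * k + 3) < (2 * k + 2) ^ 2\<close>.\<close>

lemma central_binomial_upper_even: "(2 * k choose k)\<^sup>2 * (2 * k + 1) \<le> 16 ^ k"
proof (induction k)
  case (Suc k)
  define c d where "c = (2 * k choose k)" and "d = (2 * Suc k choose Suc k)"
  have key: "Suc k * d = 2 * (2 * k + 1) * c"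
    unfolding c_def d_def by (rule central_binomial_Suc)
  have "(Suc k)\<^sup>2 * (d\<^sup>2 * (2 * Suc k + 1)) = (Suc k * d)\<^sup>2 * (2 * k + 3)"
    by (simp only: power_mult_distrib) (simp add: algebra_simps)
  also have "\<dots> = 4 * ((2 * k + 1) * (2 * k + 3)) * (c\<^sup>2 * (2 * k + 1))"
    unfolding key by (simp add: power2_eq_square algebra_simps)
  also have "\<dots> \<le> 4 * (4 * (Suc k)\<^sup>2) * 16 ^ k"
  proof (rule mult_mono)
    show "4 * ((2 * k + 1) * (2 * k + 3)) \<le> 4 * (4 * (Suc k)\<^sup>2)"
      by (simp add: power2_eq_square algebra_simps)
  qed (use Suc c_def in auto)
  also have "\<dots> = (Suc k)\<^sup>2 * 16 ^ Suc k" by simp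
  finally show ?case unfolding d_def by (subst (asm) mult_le_cancel1) simp
qed simp

text \<open>The estimate \<open>2 ^ m / sqrt (m + 1)\<close>, squared to stay within the naturals.
  For odd \<open>m\<close> the coefficient is half of the next even central one.\<close>

lemma central_binomial_upper: "(m choose (m div 2))\<^sup>2 * (m + 1) \<le> 4 ^ m"
proof (cases "even m")
  case True
  then obtain k where "m = 2 * k" by auto
  then show ?thesis using central_binomial_upper_even[of k] by (simp add: power_mult)
next
  case False
  then obtain k where m: "m = 2 * k + 1" by (elim oddE)
  have "Suc (2 * k + 1) choose Suc k = (2 * k + 1 choose k) + (2 * k + 1 choose Suc k)" by simp
  also have "2 * k + 1 choose Suc k = 2 * k + 1 choose k"
    using binomial_symmetric[of k "2 * k + 1"] by simp
  finally have "2 * Suc k choose Suc k = 2 * (2 * k + 1 choose k)" by simp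
  then have "(2 * (2 * k + 1 choose k))\<^sup>2 * (2 * Suc k + 1) \<le> 16 ^ Suc k"
    using central_binomial_upper_even[of "Suc k"] by (simp only:)
  then have "4 * ((2 * k + 1 choose k)\<^sup>2 * (2 * k + 3)) \<le> 16 ^ Suc k"
    by (simp only: power_mult_distrib) (simp add: algebra_simps)
  moreover have "16 ^ Suc k = 4 * (4::nat) ^ (2 * k + 1)" by (simp add: power_mult)
  ultimately have "(2 * k + 1 choose k)\<^sup>2 * (2 * k + 3) \<le> 4 ^ (2 * k + 1)" by linarith
  moreover have "(2 * k + 1 choose k)\<^sup>2 * (m + 1) \<le> (2 * k + 1 choose k)\<^sup>2 * (2 * k + 3)"
    using m by (intro mult_left_mono) auto
  ultimately show ?thesis using m by simp
qed

text \<open>For finite \<open>S\<close> the two sides differ by less than \<open>2 * k\<close>. If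
  this fails, a factor in the variables of \<open>S\<close> has rank at most
  \<open>2 ^ (card S / 2 - k)\<close>.\<close>

definition near_balanced :: "nat \<Rightarrow> nat set \<Rightarrow> nat set \<Rightarrow> bool" where
  "near_balanced k Y S \<longleftrightarrow> card S < 2 * smaller_side Y S + 2 * k"

lemma near_balanced_cong: "Y \<inter> S = Y' \<inter> S \<Longrightarrow> near_balanced k Y S \<longleftrightarrow> near_balanced k Y' S"
proof -
  assume "Y \<inter> S = Y' \<inter> S"
  then have "S \<inter> Y = S \<inter> Y'" "S - Y = S - Y'" by auto
  then show ?thesis by (simp add: near_balanced_def smaller_side_def)
qed

lemma card_near_balanced:
  assumes "finite S"
  shows "card {B. B \<subseteq> S \<and> near_balanced k B S} \<le> 2 * k * (card S choose (card S div 2))"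
proof -
  let ?m = "card S"
  \<comment> \<open>\<open>2 * k\<close> sizes cover both parities of \<open>?m\<close>; truncated
    subtraction can only shorten the interval.\<close>
  let ?J = "{?m div 2 + 1 - k..?m div 2 + k}"
  have "{B. B \<subseteq> S \<and> near_balanced k B S} \<subseteq> (\<Union>j\<in>?J. {B. B \<subseteq> S \<and> card B = j})"
  proof
    fix B assume "B \<in> {B. B \<subseteq> S \<and> near_balanced k B S}"
    then have B: "B \<subseteq> S" "near_balanced k B S" by auto
    have "card (S - B) = ?m - card B" "card B \<le> ?m" "S \<inter> B = B"
      using B(1) assms by (auto simp: card_Diff_subset card_mono finite_subset)
    then have "card B \<in> ?J"
      using B(2) by (auto simp: near_balanced_def smaller_side_def min_def split: if_splits)
    then show "B \<in> (\<Union>j\<in>?J. {B. B \<subseteq> S \<and> card B = j})" using B(1) by auto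
  qed
  then have "card {B. B \<subseteq> S \<and> near_balanced k B S} \<le> card (\<Union>j\<in>?J. {B. B \<subseteq> S \<and> card B = j})"
    using assms by (intro card_mono) auto
  also have "\<dots> \<le> (\<Sum>j\<in>?J. card {B. B \<subseteq> S \<and> card B = j})"
    by (rule card_UN_le) simp
  also have "\<dots> \<le> (\<Sum>j\<in>?J. ?m choose (?m div 2))"
    by (intro sum_mono) (simp add: n_subsets[OF assms] binomial_maximum)
  also have "\<dots> = card ?J * (?m choose (?m div 2))" by simp
  also have "\<dots> \<le> 2 * k * (?m choose (?m div 2))"
    by (intro mult_right_mono) auto
  finally show ?thesis .
qed

text \<open>As \<open>16 ^ l\<close> is the square of \<open>4 ^ l\<close>, each size accounts for
  at most a fraction \<open>1 / 4 ^ l\<close> of all subsets, and \<open>2 * 2 ^ l\<close> sizes are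
  possible.\<close>

lemma card_near_balanced_pow:
  assumes "finite S" "16 ^ l \<le> card S" "1 \<le> l"
  shows "card {B. B \<subseteq> S \<and> near_balanced (2 ^ l) B S} * 2 ^ (l - 1) \<le> 2 ^ card S"
proof -
  let ?c = "card {B. B \<subseteq> S \<and> near_balanced (2 ^ l) B S}"
  let ?b = "card S choose (card S div 2)"
  have "(?b * 4 ^ l)\<^sup>2 = ?b\<^sup>2 * 16 ^ l"
  proof -
    have "(4 ^ l)\<^sup>2 = (16::nat) ^ l" by (simp add: power2_eq_square flip: power_mult_distrib)
    then show ?thesis by (simp only: power_mult_distrib)
  qed
  also have "\<dots> \<le> ?b\<^sup>2 * (card S + 1)" using assms(2) by (intro mult_left_mono) auto
  also have "\<dots> \<le> 4 ^ card S" by (rule central_binomial_upper)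
  also have "\<dots> = (2 ^ card S)\<^sup>2" by (simp add: power2_eq_square flip: power_mult_distrib)
  finally have b: "?b * 4 ^ l \<le> 2 ^ card S" by (simp only: power2_nat_le_eq_le)
  have "?c * 2 ^ (l - 1) \<le> 2 * 2 ^ l * ?b * 2 ^ (l - 1)"
    by (intro mult_right_mono card_near_balanced assms) auto
  also have "\<dots> = 2 ^ l * ?b * (2 * 2 ^ (l - 1))" by simp
  also have "2 * 2 ^ (l - 1) = (2::nat) ^ l"
    using assms(3) by (simp flip: power_Suc)
  also have "2 ^ l * ?b * 2 ^ l = ?b * 4 ^ l" by (simp flip: power_mult_distrib)
  finally show ?thesis using b by linarith
qed

lemma parts_subset: "parts T V \<Longrightarrow> S \<in> set T \<Longrightarrow> S \<subseteq> V"
  by (induction T arbitrary: V) auto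

text \<open>Independence of the blocks: a set is determined by its traces on them, so the fractions
  \<open>1 / c\<close> multiply.\<close>

lemma card_all_near_balanced:
  assumes "finite V" "parts T V"
    "\<And>S. S \<in> set T \<Longrightarrow> card {B. B \<subseteq> S \<and> near_balanced k B S} * c \<le> 2 ^ card S"
  shows "card {Y. Y \<subseteq> V \<and> (\<forall>S\<in>set T. near_balanced k Y S)} * c ^ length T \<le> 2 ^ card V"
  using assms
proof (induction T arbitrary: V)
  case Nil
  then show ?case by simp
next
  case (Cons S T)
  then have S: "S \<subseteq> V" "parts T (V - S)" by auto
  have sub: "S' \<subseteq> V - S" if "S' \<in> set T" for S'
    using parts_subset[OF S(2) that] .
  let ?Z = "{Y. Y \<subseteq> V \<and> (\<forall>S\<in>set (S # T). near_balanced k Y S)}"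
  let ?P = "{B. B \<subseteq> S \<and> near_balanced k B S}"
  let ?Q = "{Y. Y \<subseteq> V - S \<and> (\<forall>S\<in>set T. near_balanced k Y S)}"
  have "inj_on (\<lambda>Y. (Y \<inter> S, Y - S)) ?Z"
    by (rule inj_onI) blast
  moreover have "(\<lambda>Y. (Y \<inter> S, Y - S)) ` ?Z \<subseteq> ?P \<times> ?Q"
  proof (rule image_subsetI)
    fix Y assume "Y \<in> ?Z"
    then have Y: "Y \<subseteq> V" "\<forall>S\<in>set (S # T). near_balanced k Y S" by auto
    have 1: "near_balanced k (Y \<inter> S) S" using Y near_balanced_cong[of "Y \<inter> S" S Y] by auto
    have "\<forall>S'\<in>set T. near_balanced k (Y - S) S'"
    proof
      fix S' assume "S' \<in> set T"
      then have "(Y - S) \<inter> S' = Y \<inter> S'" using sub[of S'] by auto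
      from near_balanced_cong[OF this] show "near_balanced k (Y - S) S'"
        using Y \<open>S' \<in> set T\<close> by auto
    qed
    with 1 Y(1) show "(Y \<inter> S, Y - S) \<in> ?P \<times> ?Q" by auto
  qed
  moreover have "finite (?P \<times> ?Q)" using Cons.prems(1) finite_subset[OF S(1)] by simp
  ultimately have "card ?Z \<le> card (?P \<times> ?Q)" by (rule card_inj_on_le)
  then have "card ?Z \<le> card ?P * card ?Q" by (simp only: card_cartesian_product)
  then have "card ?Z * c ^ length (S # T) \<le> (card ?P * card ?Q) * c ^ length (S # T)"
    by (rule mult_right_mono) simp
  also have "\<dots> = (card ?P * c) * (card ?Q * c ^ length T)" by simp
  also have "\<dots> \<le> 2 ^ card S * 2 ^ card (V - S)"
    using Cons.prems S by (intro mult_mono Cons.IH) auto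
  also have "\<dots> = 2 ^ card V"
    using Cons.prems(1) S(1)
    by (simp add: card_Diff_subset finite_subset card_mono flip: power_add)
  finally show ?case .
qed

lemma smaller_side_le: "finite S \<Longrightarrow> 2 * smaller_side Y S \<le> card S"
  using card_Int_Diff[of S Y] by (auto simp: smaller_side_def)

lemma tuple_bound_sq:
  assumes "finite V" "parts T V"
  shows "(tuple_bound Y T)\<^sup>2 \<le> 2 ^ card V"
  using assms
proof (induction T arbitrary: V)
  case (Cons S T)
  then have S: "S \<subseteq> V" "finite S" "parts T (V - S)" by (auto intro: finite_subset)
  have "(tuple_bound Y (S # T))\<^sup>2 = 2 ^ (2 * smaller_side Y S) * (tuple_bound Y T)\<^sup>2"
    by (simp add: power_mult_distrib power_mult mult.commute flip: power_mult)
  also have "\<dots> \<le> 2 ^ card S * 2 ^ card (V - S)"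
    using Cons.prems S by (intro mult_mono Cons.IH power_increasing smaller_side_le) auto
  also have "\<dots> = 2 ^ card V"
    using Cons.prems(1) S(1)
    by (simp add: card_Diff_subset finite_subset card_mono flip: power_add)
  finally show ?case .
qed simp

text \<open>Every block adds at most half of its size to the exponent, and the uneven block adds at
  least \<open>k\<close> less than half. Squaring avoids the halves.\<close>

lemma tuple_bound_deficit:
  assumes "finite V" "parts T V" "S \<in> set T" "\<not> near_balanced k Y S"
  shows "(tuple_bound Y T)\<^sup>2 * 4 ^ k \<le> 2 ^ card V"
  using assms(1-3)
proof (induction T arbitrary: V)
  case (Cons S' T)
  then have S': "S' \<subseteq> V" "finite S'" "parts T (V - S')" by (auto intro: finite_subset)
  have eq: "(tuple_bound Y (S' # T))\<^sup>2 = 2 ^ (2 * smaller_side Y S') * (tuple_bound Y T)\<^sup>2"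
    by (simp add: power_mult_distrib power_mult mult.commute flip: power_mult)
  have fin: "2 ^ card S' * 2 ^ card (V - S') = (2::nat) ^ card V"
    using Cons.prems(1) S'(1)
    by (simp add: card_Diff_subset finite_subset card_mono flip: power_add)
  show ?case
  proof (cases "S = S'")
    case True
    have "2 ^ (2 * smaller_side Y S') * 4 ^ k = (2::nat) ^ (2 * smaller_side Y S' + 2 * k)"
      by (simp add: power_add power_mult)
    also have "\<dots> \<le> 2 ^ card S'"
      using assms(4) True by (intro power_increasing) (auto simp: near_balanced_def)
    finally have "(2 ^ (2 * smaller_side Y S') * 4 ^ k) * (tuple_bound Y T)\<^sup>2 \<le> 2 ^ card S' * 2 ^ card (V - S')"
      using Cons.prems(1) S' by (intro mult_mono tuple_bound_sq) auto
    then show ?thesis unfolding eq fin by (simp add: mult_ac)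
  next
    case False
    have "2 ^ (2 * smaller_side Y S') * ((tuple_bound Y T)\<^sup>2 * 4 ^ k) \<le> 2 ^ card S' * 2 ^ card (V - S')"
      using Cons.prems S' False
      by (intro mult_mono Cons.IH power_increasing smaller_side_le) auto
    then show ?thesis unfolding eq fin by (simp add: mult_ac)
  qed
qed simp

text \<open>If for some balanced \<open>Y\<close> every tuple has an uneven block, each tuple bounds
  a rank of at most \<open>2 ^ h / 2 ^ 2 ^ l\<close>, so about \<open>2 ^ 2 ^ l\<close> tuples are
  needed. Otherwise each of the at least \<open>4 ^ h / (2 * h)\<close> balanced sets is nearly even
  on all blocks of some tuple, and one tuple serves at most
  \<open>4 ^ h / 2 ^ ((l - 1) * (2 * l + 1))\<close> of them. The \<open>+ 1\<close> in the
  hypothesis allows for the constant in \<open>1 + 2 f\<close>.\<close>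

lemma multilinear_formula_lower_bound:
  fixes \<Phi> :: "'a::field aterm"
  assumes ml: "syntactically_multilinear \<Phi>" and l: "1 \<le> l" and h: "2 * h = 2 ^ (8 * l)"
    and rank: "\<And>Y. Y \<subseteq> {..<2 * h} \<Longrightarrow> card Y = h \<Longrightarrow>
      \<exists>U. \<forall>r. rk_le Y (bool_fun {..<2 * h} U \<Phi>) r \<longrightarrow> 2 ^ h \<le> r + 1"
  shows "2 ^ ((l - 1) * (2 * l + 1)) \<le> (1 + 2 * l * var_leaves \<Phi>) * 2 ^ (8 * l) \<or>
    2 ^ 2 ^ l \<le> 2 + 2 * l * var_leaves \<Phi>"
proof -
  let ?V = "{..<2 * h}"
  \<comment> \<open>The origin of \<open>8 * l\<close>: blocks of size \<open>16 ^ l\<close> and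
    \<open>2 * l\<close> levels, each at the price of a factor 3, rounded up to 4.\<close>
  have "3 ^ (2 * l) * 16 ^ l \<le> (4::nat) ^ (2 * l) * 16 ^ l"
    by (intro mult_right_mono power_mono) auto
  also have "\<dots> = 2 * h" unfolding h by (simp add: power_mult flip: power_mult_distrib)
  finally have c: "3 ^ (2 * l) * 16 ^ l \<le> card ?V" by simp
  from formula_decomposition[OF _ _ ml _ _ this, of ?V] obtain TT where TT:
    "length TT \<le> 1 + 2 * l * var_leaves \<Phi>" "decomposed (16 ^ l) (2 * l) ?V TT"
    "\<And>Y U. rk_le Y (bool_fun ?V U \<Phi>) (\<Sum>T\<leftarrow>TT. tuple_bound Y T)"
    by auto
  have T: "length T = Suc (2 * l)" "parts T ?V" "\<And>S. S \<in> set T \<Longrightarrow> 16 ^ l \<le> card S"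
    if "T \<in> set TT" for T
    using TT(2) that by (auto simp: decomposed_def)
  let ?near = "\<lambda>Y T. \<forall>S\<in>set T. near_balanced (2 ^ l) Y S"
  show ?thesis
  proof (cases "\<exists>Y\<subseteq>?V. card Y = h \<and> (\<forall>T\<in>set TT. \<not> ?near Y T)")
    case True
    then obtain Y where Y: "Y \<subseteq> ?V" "card Y = h" "\<And>T. T \<in> set TT \<Longrightarrow> \<not> ?near Y T" by blast
    obtain U where U: "\<And>r. rk_le Y (bool_fun ?V U \<Phi>) r \<Longrightarrow> 2 ^ h \<le> r + 1"
      using rank[OF Y(1,2)] by blast
    have tb: "tuple_bound Y T * 2 ^ 2 ^ l \<le> 2 ^ h" if T_in: "T \<in> set TT" for T
    proof -
      obtain S where "S \<in> set T" "\<not> near_balanced (2 ^ l) Y S" using Y(3)[OF \<open>T \<in> set TT\<close>] by blast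
      then have "(tuple_bound Y T)\<^sup>2 * 4 ^ 2 ^ l \<le> 2 ^ card ?V"
        using T(2)[OF T_in] by (intro tuple_bound_deficit) auto
      moreover have "(4::nat) ^ 2 ^ l = (2 ^ 2 ^ l)\<^sup>2"
        by (simp add: power2_eq_square flip: power_mult_distrib)
      moreover have "(2::nat) ^ card ?V = (2 ^ h)\<^sup>2" by (simp add: power_mult mult.commute flip: power_mult)
      ultimately have "(tuple_bound Y T * 2 ^ 2 ^ l)\<^sup>2 \<le> (2 ^ h)\<^sup>2" by (simp only: power_mult_distrib)
      then show ?thesis by (simp only: power2_nat_le_eq_le)
    qed
    have "(\<Sum>T\<leftarrow>TT. tuple_bound Y T) * 2 ^ 2 ^ l = (\<Sum>T\<leftarrow>TT. tuple_bound Y T * 2 ^ 2 ^ l)"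
      by (simp add: sum_list_mult_const)
    also have "\<dots> \<le> (\<Sum>T\<leftarrow>TT. 2 ^ h)" by (intro sum_list_mono tb)
    also have "\<dots> = length TT * 2 ^ h" by (simp add: sum_list_triv)
    finally have r: "(\<Sum>T\<leftarrow>TT. tuple_bound Y T) * 2 ^ 2 ^ l \<le> length TT * 2 ^ h" .
    \<comment> \<open>With this the \<open>+ 1\<close> in the rank bound costs no more than one
      additional tuple.\<close>
    have "(2::nat) ^ 2 ^ l \<le> 2 ^ h"
    proof (rule power_increasing)
      have "2 * 2 ^ l \<le> (2::nat) ^ (8 * l)" unfolding power_Suc[symmetric]
        using l by (intro power_increasing) auto
      then show "2 ^ l \<le> h" using h by linarith
    qed simp
    moreover have "2 ^ h * 2 ^ 2 ^ l \<le> ((\<Sum>T\<leftarrow>TT. tuple_bound Y T) + 1) * 2 ^ 2 ^ l"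
      by (intro mult_right_mono U TT(3)) auto
    ultimately have "2 ^ h * 2 ^ 2 ^ l \<le> 2 ^ h + length TT * 2 ^ h"
      using r unfolding add_mult_distrib by linarith
    then have "2 ^ h * 2 ^ 2 ^ l \<le> 2 ^ h * (length TT + 1)" by (simp add: algebra_simps)
    then have "2 ^ 2 ^ l \<le> length TT + 1" by (subst (asm) mult_le_cancel1) simp
    then show ?thesis using TT(1) by linarith
  next
    case False
    define c where "c = (2::nat) ^ ((l - 1) * (2 * l + 1))"
    let ?F = "\<lambda>T. {Y. Y \<subseteq> ?V \<and> ?near Y T}"
    have F: "card (?F T) * c \<le> 4 ^ h" if T_in: "T \<in> set TT" for T
    proof -
      have "card {B. B \<subseteq> S \<and> near_balanced (2 ^ l) B S} * 2 ^ (l - 1) \<le> 2 ^ card S" if "S \<in> set T" for S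
        using T(3)[OF T_in that] l finite_subset[OF parts_subset[OF T(2)[OF T_in] that]]
        by (intro card_near_balanced_pow) auto
      then have "card (?F T) * (2 ^ (l - 1)) ^ length T \<le> 2 ^ card ?V"
        using T(2)[OF T_in] by (intro card_all_near_balanced) auto
      moreover have "(2 ^ (l - 1)) ^ length T = c"
        by (simp only: T(1)[OF T_in] c_def power_mult[symmetric]) simp
      moreover have "(2::nat) ^ card ?V = 4 ^ h" by (simp add: power_mult)
      ultimately show ?thesis by simp
    qed
    have "{Y. Y \<subseteq> ?V \<and> card Y = h} \<subseteq> (\<Union>T\<in>set TT. ?F T)" using False by blast
    then have "card {Y. Y \<subseteq> ?V \<and> card Y = h} \<le> card (\<Union>T\<in>set TT. ?F T)"
      by (intro card_mono) auto
    also have "\<dots> \<le> (\<Sum>T\<in>set TT. card (?F T))" by (rule card_UN_le) simp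
    finally have "(2 * h choose h) * c \<le> (\<Sum>T\<in>set TT. card (?F T)) * c"
      by (simp add: n_subsets)
    also have "\<dots> = (\<Sum>T\<in>set TT. card (?F T) * c)" by (rule sum_distrib_right)
    also have "\<dots> \<le> (\<Sum>T\<in>set TT. 4 ^ h)" by (intro sum_mono F)
    also have "\<dots> \<le> length TT * 4 ^ h" by (simp add: card_length)
    also have "\<dots> \<le> length TT * (2 * h * (2 * h choose h))"
    proof (intro mult_left_mono)
      have "0 < h" using h by (cases h) auto
      then have "4 ^ h / (2 * real h) \<le> real (2 * h choose h)"
        by (rule central_binomial_lower_bound)
      then have "real (4 ^ h) \<le> real (2 * h * (2 * h choose h))"
        using \<open>0 < h\<close> by (simp add: field_simps)
      then show "4 ^ h \<le> 2 * h * (2 * h choose h)" by (simp only: of_nat_le_iff)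
    qed simp
    finally have "(2 * h choose h) * c \<le> (2 * h choose h) * (length TT * (2 * h))" by (simp add: mult_ac)
    then have "c \<le> length TT * (2 * h)"
      by (subst (asm) mult_le_cancel1) simp
    also have "\<dots> \<le> (1 + 2 * l * var_leaves \<Phi>) * (2 * h)" by (intro mult_right_mono TT) auto
    finally show ?thesis unfolding c_def h by blast
  qed
qed

section \<open>Balanced splittings of unions of two intervals\<close>

text \<open>Single intervals would not do: an interval on which the signs are \<open>+ + - -\<close>
  is not a union of two smaller balanced intervals. With two intervals every balanced set of at
  least four elements splits, and there are still only polynomially many shapes.\<close>

definition two_intervals :: "nat \<Rightarrow> nat set \<Rightarrow> bool" where
  "two_intervals n S \<longleftrightarrow> (\<exists>a b c d. a \<le> b \<and> b \<le> n \<and> c \<le> d \<and> d \<le> n \<and>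
     {a..<b} \<inter> {c..<d} = {} \<and> S = {a..<b} \<union> {c..<d})"

lemma two_intervalsI:
  "a \<le> b \<Longrightarrow> b \<le> n \<Longrightarrow> c \<le> d \<Longrightarrow> d \<le> n \<Longrightarrow> {a..<b} \<inter> {c..<d} = {} \<Longrightarrow>
    two_intervals n ({a..<b} \<union> {c..<d})"
  unfolding two_intervals_def by blast

lemma two_intervals_single: "a \<le> b \<Longrightarrow> b \<le> n \<Longrightarrow> two_intervals n {a..<b}"
  using two_intervalsI[of a b n 0 0] by simp

lemma finite_two_intervals: "two_intervals n S \<Longrightarrow> finite S"
  unfolding two_intervals_def by auto

text \<open>A walk with steps of size at most 1 cannot jump over an integer.\<close>

lemma walk_intermediate_value:
  fixes f :: "nat \<Rightarrow> int"
  assumes "\<And>i. \<bar>f i\<bar> \<le> 1" "a \<le> p" "p \<le> q"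
    "sum f {a..<p} \<le> v \<and> v \<le> sum f {a..<q} \<or> sum f {a..<q} \<le> v \<and> v \<le> sum f {a..<p}"
  shows "\<exists>x. p \<le> x \<and> x \<le> q \<and> sum f {a..<x} = v"
proof -
  have *: "\<exists>x. p \<le> x \<and> x \<le> q \<and> sum f {a..<x} = v"
    if "\<And>i. \<bar>f i\<bar> \<le> 1" "sum f {a..<p} \<le> v" "v \<le> sum f {a..<q}" for f :: "nat \<Rightarrow> int" and v
  proof -
    have "\<forall>i. p \<le> i \<and> i < q \<longrightarrow> \<bar>sum f {a..<Suc i} - sum f {a..<i}\<bar> \<le> 1"
      using that(1) assms(2) by (auto simp: sum.atLeastLessThan_Suc)
    then show ?thesis
      using nat_intermed_int_val[of p q "\<lambda>x. sum f {a..<x}" v] assms(3) that(2,3) by auto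
  qed
  show ?thesis
    using assms(4)
  proof
    assume "sum f {a..<p} \<le> v \<and> v \<le> sum f {a..<q}"
    then show ?thesis using *[of f v] assms(1) by auto
  next
    assume "sum f {a..<q} \<le> v \<and> v \<le> sum f {a..<p}"
    then show ?thesis using *[of "\<lambda>i. - f i" "- v"] assms(1) by (auto simp: sum_negf)
  qed
qed

definition splits_into :: "nat \<Rightarrow> (nat \<Rightarrow> int) \<Rightarrow> nat set \<Rightarrow> nat set \<Rightarrow> nat set \<Rightarrow> bool" where
  "splits_into n f S S1 S2 \<longleftrightarrow> two_intervals n S1 \<and> two_intervals n S2 \<and> S1 \<inter> S2 = {} \<and>
     S1 \<union> S2 = S \<and> S1 \<noteq> {} \<and> S2 \<noteq> {} \<and> sum f S1 = 0 \<and> sum f S2 = 0"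

lemma splits_intoI:
  fixes f :: "nat \<Rightarrow> int"
  assumes S: "S1 \<union> S2 = S" "S1 \<inter> S2 = {}"
    and "sum f S = 0" "sum f S1 = 0" "two_intervals n S1" "two_intervals n S2"
      "S1 \<noteq> {}" "S2 \<noteq> {}"
  shows "splits_into n f S S1 S2"
proof -
  have "finite S1" "finite S2" using assms finite_two_intervals by blast+
  then have "sum f S = sum f S1 + sum f S2" using S sum.union_disjoint by blast
  then show ?thesis using assms by (simp add: splits_into_def)
qed

text \<open>Cut the longer interval in the middle, at \<open>h\<close>. If \<open>p\<close> is
  between \<open>0\<close> and \<open>s\<close>, the walk over the other interval meets
  \<open>- p\<close>, and both intervals are cut. If \<open>s\<close> is between \<open>0\<close>
  and \<open>p\<close>, the walk from \<open>a\<close> meets \<open>s\<close> before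
  \<open>h\<close>; if \<open>0\<close> is between \<open>p\<close> and \<open>s\<close>, it returns
  to \<open>0\<close> after \<open>h\<close>. In the last two cases one piece is a single interval
  that may be long, whence the second alternative for \<open>S1\<close>; it is left to a further
  split.\<close>

lemma balanced_pair_split:
  fixes f :: "nat \<Rightarrow> int"
  assumes f: "\<And>i. \<bar>f i\<bar> \<le> 1" and ab: "a < b" "b \<le> n" and cd: "c < d" "d \<le> n"
    and disj: "{a..<b} \<inter> {c..<d} = {}" and sum0: "sum f ({a..<b} \<union> {c..<d}) = 0"
    and len: "d - c \<le> b - a" "2 \<le> b - a"
  shows "\<exists>S1 S2. splits_into n f ({a..<b} \<union> {c..<d}) S1 S2 \<and>
    6 * card S2 \<le> 5 * (b - a + (d - c)) \<and>
    (6 * card S1 \<le> 5 * (b - a + (d - c)) \<or> (\<exists>a' b'. a' \<le> b' \<and> b' \<le> n \<and> S1 = {a'..<b'}) \<and> card S1 \<le> b - a)"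
proof -
  define h where "h = a + (b - a) div 2"
  have h: "a < h" "h < b" "3 * (h - a) \<ge> b - a" "2 * (b - h) \<ge> b - a"
    using len unfolding h_def by auto
  have split_ba: "b - a = (h - a) + (b - h)" using h by simp
  have split_cd: "d - c = (y - c) + (d - y)" if "c \<le> y" "y \<le> d" for y using that by simp
  \<comment> \<open>A piece that misses a third of the longer interval misses a sixth of the whole,
    which is the origin of 5/6.\<close>
  have sizes: "6 * (v + g) \<le> 5 * (p + q)" "6 * (u + e) \<le> 5 * (p + q)"
    if "p \<le> 3 * u" "p \<le> 2 * v" "q \<le> p" "p = u + v" "q = e + g" for p q u v e g :: nat
    using that by auto
  define p s where "p = sum f {a..<h}" and "s = sum f {a..<b}"
  have sB: "sum f {c..<d} = - s"
    using sum0 disj by (simp add: sum.union_disjoint s_def)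
  have ds: "x < c \<or> d \<le> x" if "a \<le> x" "x < b" for x
    using disj that by (metis atLeastLessThan_iff disjoint_iff linorder_not_le)
  consider "0 \<le> p \<and> p \<le> s \<or> s \<le> p \<and> p \<le> 0" | "0 \<le> s \<and> s < p \<or> p < s \<and> s \<le> 0"
    | "p < 0 \<and> 0 \<le> s \<or> s \<le> 0 \<and> 0 < p" by linarith
  then show ?thesis
  proof cases
    case 1
    then have "\<exists>x. c \<le> x \<and> x \<le> d \<and> sum f {c..<x} = - p"
      using h cd sB by (intro walk_intermediate_value f) (auto simp: p_def s_def)
    then obtain y where y: "c \<le> y" "y \<le> d" "sum f {c..<y} = - p" by blast
    have dj: "{a..<h} \<inter> {c..<y} = {}" "{h..<b} \<inter> {y..<d} = {}" using disj h y by auto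
    have "splits_into n f ({a..<b} \<union> {c..<d}) ({a..<h} \<union> {c..<y}) ({h..<b} \<union> {y..<d})"
      using ab cd h y disj sum0 dj
      by (intro splits_intoI two_intervalsI) (auto simp: sum.union_disjoint p_def)
    moreover have "card ({a..<h} \<union> {c..<y}) = (h - a) + (y - c)"
      "card ({h..<b} \<union> {y..<d}) = (b - h) + (d - y)"
      using dj by (simp_all add: card_Un_disjoint)
    moreover have "6 * ((b - h) + (d - y)) \<le> 5 * (b - a + (d - c))"
      "6 * ((h - a) + (y - c)) \<le> 5 * (b - a + (d - c))"
      using sizes[OF h(3,4) len(1) split_ba split_cd[OF y(1,2)]] by simp_all
    ultimately show ?thesis by metis
  next
    case 2
    then have "\<exists>x. a \<le> x \<and> x \<le> h \<and> sum f {a..<x} = s"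
      using h cd sB by (intro walk_intermediate_value f) (auto simp: p_def s_def)
    then obtain x where x: "a \<le> x" "x \<le> h" "sum f {a..<x} = s" by blast
    have dj: "{a..<x} \<inter> {c..<d} = {}" using disj h x by auto
    have "sum f {x..<b} = 0"
      using x h sum.atLeastLessThan_concat[of a x b f] unfolding s_def by auto
    then have "splits_into n f ({a..<b} \<union> {c..<d}) {x..<b} ({a..<x} \<union> {c..<d})"
      using ab cd h x disj sum0 dj
      by (intro splits_intoI two_intervalsI two_intervals_single) auto
    moreover have "card ({a..<x} \<union> {c..<d}) = (x - a) + (d - c)"
      using dj by (simp add: card_Un_disjoint)
    moreover have "x - a \<le> h - a" "6 * ((h - a) + (d - c)) \<le> 5 * (b - a + (d - c))"
      using x sizes[OF h(3,4) len(1) split_ba, of "d - c" 0] by auto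
    then have "6 * ((x - a) + (d - c)) \<le> 5 * (b - a + (d - c))"
      by (meson add_le_mono1 mult_le_mono2 order_trans)
    moreover have "card {x..<b} \<le> b - a" "x \<le> b" using x h by auto
    ultimately show ?thesis using ab by metis
  next
    case 3
    then have "\<exists>x. h \<le> x \<and> x \<le> b \<and> sum f {a..<x} = 0"
      using h cd sB by (intro walk_intermediate_value f) (auto simp: p_def s_def)
    then obtain x where x: "h \<le> x" "x \<le> b" "sum f {a..<x} = 0" by blast
    have dj: "{x..<b} \<inter> {c..<d} = {}" using disj h x by auto
    have "splits_into n f ({a..<b} \<union> {c..<d}) {a..<x} ({x..<b} \<union> {c..<d})"
      using ab cd h x disj sum0 dj
      by (intro splits_intoI two_intervalsI two_intervals_single) auto
    moreover have "card ({x..<b} \<union> {c..<d}) = (b - x) + (d - c)"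
      using dj by (simp add: card_Un_disjoint)
    moreover have "b - x \<le> b - h" "6 * ((b - h) + (d - c)) \<le> 5 * (b - a + (d - c))"
      using x sizes[OF h(3,4) len(1) split_ba, of 0 "d - c"] by auto
    then have "6 * ((b - x) + (d - c)) \<le> 5 * (b - a + (d - c))"
      by (meson add_le_mono1 mult_le_mono2 order_trans)
    moreover have "card {a..<x} \<le> b - a" "a \<le> x" "x \<le> n" using x h ab by auto
    ultimately show ?thesis by metis
  qed
qed

text \<open>Read as two adjacent halves: the exceptional piece of \<open>balanced_pair_split\<close>
  is then no longer than the larger half, so both pieces shrink.\<close>

lemma balanced_interval_split:
  fixes f :: "nat \<Rightarrow> int"
  assumes f: "\<And>i. \<bar>f i\<bar> \<le> 1" and ab: "b \<le> n" "4 \<le> b - a" and sum0: "sum f {a..<b} = 0"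
  shows "\<exists>S1 S2. splits_into n f {a..<b} S1 S2 \<and> 6 * card S1 \<le> 5 * (b - a) \<and> 6 * card S2 \<le> 5 * (b - a)"
proof -
  define h where "h = a + (b - a + 1) div 2"
  have h: "a < h" "h < b" "b - h \<le> h - a" "2 \<le> h - a" "6 * (h - a) \<le> 5 * (b - a)"
    "h - a + (b - h) = b - a"
    using ab unfolding h_def by auto
  have "{a..<h} \<union> {h..<b} = {a..<b}" "{a..<h} \<inter> {h..<b} = {}" using h by auto
  then show ?thesis
    using balanced_pair_split[where f=f and a=a and b=h and n=n and c=h and d=b, OF f] h ab sum0 by (fastforce simp: h(6))
qed

lemma even_card_balanced:
  fixes f :: "nat \<Rightarrow> int"
  assumes "finite S" "\<And>i. f i = 1 \<or> f i = -1" "sum f S = 0"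
  shows "even (card S)"
proof -
  have "even (sum f S) \<longleftrightarrow> even (card S)"
    using assms(1)
  proof (induction S rule: finite_induct)
    case (insert i S)
    then show ?case using assms(2)[of i] by auto
  qed simp
  then show ?thesis using assms(3) by simp
qed

text \<open>\<open>k\<close> counts splitting steps and \<open>j\<close> factors 5/6. One factor may
  take two steps, the first leaving a long interval and the second cutting it. At
  \<open>j = 0\<close> at most two elements are left, and by parity exactly two.\<close>

lemma balanced_induct:
  fixes f :: "nat \<Rightarrow> int" and P :: "nat \<Rightarrow> nat set \<Rightarrow> bool"
  assumes f: "\<And>i. f i = 1 \<or> f i = -1"
    and base: "\<And>k S. two_intervals n S \<Longrightarrow> sum f S = 0 \<Longrightarrow> card S = 2 \<Longrightarrow> P k S"
    and step: "\<And>k S S1 S2. two_intervals n S \<Longrightarrow> splits_into n f S S1 S2 \<Longrightarrow> P k S1 \<Longrightarrow> P k S2 \<Longrightarrow> P (Suc k) S"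
    and S: "two_intervals n S" "sum f S = 0" "S \<noteq> {}"
    and "5 ^ j * card S \<le> 2 * 6 ^ j" "2 * j \<le> k"
  shows "P k S"
  using S assms(7,8)
proof (induction j arbitrary: k S)
  case 0
  have "finite S" using 0 finite_two_intervals by blast
  then have "card S \<noteq> 0" "even (card S)" using 0 even_card_balanced[OF _ f] by auto
  then have "card S = 2" using 0 by (auto elim!: evenE)
  then show ?case using base 0 by auto
next
  case (Suc j)
  have f1: "\<bar>f i\<bar> \<le> 1" for i using f[of i] by auto
  have small: "5 ^ j * card S' \<le> 2 * 6 ^ j"
    if "6 * card S' \<le> 5 * c" "5 ^ Suc j * c \<le> 2 * 6 ^ Suc j" for S' :: "nat set" and c
  proof -
    have "6 * (5 ^ j * card S') = 5 ^ j * (6 * card S')" by simp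
    also have "\<dots> \<le> 5 ^ j * (5 * c)" using that(1) by (intro mult_left_mono) auto
    also have "\<dots> \<le> 6 * (2 * 6 ^ j)" using that(2) by simp
    finally show ?thesis by linarith
  qed
  have card_ge: "card S = 2 \<or> 4 \<le> card S" if "two_intervals n S" "sum f S = 0" "S \<noteq> {}" for S
  proof -
    have "finite S" using that finite_two_intervals by blast
    then have "card S \<noteq> 0" "even (card S)" using that even_card_balanced[OF _ f] by auto
    then show ?thesis by (auto elim!: evenE)
  qed
  \<comment> \<open>An interval shrinks in a single step, so one step beyond \<open>2 * j\<close>
    suffices.\<close>
  have interval: "P k {a..<b}"
    if ivl: "b \<le> n" "a < b" "sum f {a..<b} = 0" "5 ^ Suc j * (b - a) \<le> 2 * 6 ^ Suc j" "2 * j < k" for a b k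
  proof -
    have ti: "two_intervals n {a..<b}" using ivl by (intro two_intervals_single) auto
    show ?thesis
    proof (cases "card {a..<b} = 2")
      case True
      then show ?thesis using base[OF ti] ivl by auto
    next
      case False
      then have "4 \<le> b - a" using card_ge[OF ti] ivl by auto
      then obtain S1 S2 where sp: "splits_into n f {a..<b} S1 S2"
        "6 * card S1 \<le> 5 * (b - a)" "6 * card S2 \<le> 5 * (b - a)"
        using balanced_interval_split[where f=f and a=a and b=b and n=n, OF f1] ivl by blast
      obtain k' where k': "k = Suc k'" "2 * j \<le> k'" using \<open>2 * j < k\<close> by (cases k) auto
      have "P k' S1" "P k' S2"
        using sp(1) Suc.IH[OF _ _ _ small[OF sp(2) ivl(4)] k'(2)]
          Suc.IH[OF _ _ _ small[OF sp(3) ivl(4)] k'(2)]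
        by (auto simp: splits_into_def)
      then show ?thesis using step[OF ti sp(1)] k' by auto
    qed
  qed
  show ?case
  proof (cases "card S = 2")
    case True
    then show ?thesis using base Suc by auto
  next
    case False
    then have c4: "4 \<le> card S" using card_ge Suc.prems by blast
    have "\<exists>a b c d. a \<le> b \<and> b \<le> n \<and> c \<le> d \<and> d \<le> n \<and> {a..<b} \<inter> {c..<d} = {} \<and>
        S = {a..<b} \<union> {c..<d} \<and> d - c \<le> b - a"
    proof -
      obtain a b c d where *: "a \<le> b" "b \<le> n" "c \<le> d" "d \<le> n" "{a..<b} \<inter> {c..<d} = {}"
        "S = {a..<b} \<union> {c..<d}"
        using Suc.prems(1) unfolding two_intervals_def by blast
      show ?thesis
      proof (cases "d - c \<le> b - a")
        case True
        then show ?thesis using * by blast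
      next
        case False
        then have "b - a \<le> d - c" by simp
        moreover have "{c..<d} \<inter> {a..<b} = {}" "S = {c..<d} \<union> {a..<b}" using * by auto
        ultimately show ?thesis using * by blast
      qed
    qed
    then obtain a b c d where *: "a \<le> b" "b \<le> n" "c \<le> d" "d \<le> n" "{a..<b} \<inter> {c..<d} = {}"
      "S = {a..<b} \<union> {c..<d}" "d - c \<le> b - a" by blast
    have cS: "card S = b - a + (d - c)" using * by (simp add: card_Un_disjoint)
    show ?thesis
    proof (cases "c < d")
      case False
      then have "S = {a..<b}" "card S = b - a" using * by auto
      then show ?thesis using interval[of b a k] Suc.prems * c4 by auto
    next
      case True
      have "2 \<le> b - a" using c4 cS *(7) by auto
      then obtain S1 S2 where sp: "splits_into n f S S1 S2"
        and S2: "6 * card S2 \<le> 5 * card S"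
        and S1: "6 * card S1 \<le> 5 * card S \<or>
          (\<exists>a' b'. a' \<le> b' \<and> b' \<le> n \<and> S1 = {a'..<b'}) \<and> card S1 \<le> card S"
      proof -
        have "\<exists>S1 S2. splits_into n f S S1 S2 \<and> 6 * card S2 \<le> 5 * card S \<and>
            (6 * card S1 \<le> 5 * card S \<or>
              (\<exists>a' b'. a' \<le> b' \<and> b' \<le> n \<and> S1 = {a'..<b'}) \<and> card S1 \<le> b - a)"
          unfolding cS unfolding *(6)
          by (rule balanced_pair_split)
            (use * True \<open>2 \<le> b - a\<close> f1 Suc.prems(2) in auto)
        moreover have "b - a \<le> card S" using cS by simp
        ultimately show ?thesis using that order_trans by blast
      qed
      obtain k' where k': "k = Suc k'" "2 * j \<le> k'" "2 * j < k'"
        using Suc.prems(5) by (cases k) auto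
      note S12 = sp[unfolded splits_into_def]
      have "P k' S2"
        using S12 Suc.IH[OF _ _ _ small[OF S2 Suc.prems(4)] k'(2)] by blast
      moreover have "P k' S1"
        using S1
      proof
        assume "6 * card S1 \<le> 5 * card S"
        then show ?thesis using S12 Suc.IH[OF _ _ _ small[OF _ Suc.prems(4)] k'(2)] by blast
      next
        assume "(\<exists>a' b'. a' \<le> b' \<and> b' \<le> n \<and> S1 = {a'..<b'}) \<and> card S1 \<le> card S"
        then obtain a' b' where a': "a' \<le> b'" "b' \<le> n" "S1 = {a'..<b'}" "card S1 \<le> card S" by blast
        have "5 ^ Suc j * (b' - a') \<le> 5 ^ Suc j * card S"
          using a' by (intro mult_left_mono) auto
        then have "5 ^ Suc j * (b' - a') \<le> 2 * 6 ^ Suc j" using Suc.prems(4) by linarith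
        moreover have "a' < b'" using S12 a' by auto
        ultimately show ?thesis unfolding a'(3) using S12 a' k'(3) by (intro interval) auto
      qed
      ultimately show ?thesis using step[OF Suc.prems(1) sp] k' by auto
    qed
  qed
qed

section \<open>A circuit of full rank for every balanced partition\<close>

text \<open>A complete binary tree, to keep the depth logarithmic in the number of summands.\<close>

primrec balanced_sum :: "nat \<Rightarrow> (nat \<Rightarrow> 'a aterm) \<Rightarrow> 'a aterm" where
  "balanced_sum 0 f = f 0"
| "balanced_sum (Suc d) f = AAdd (balanced_sum d f) (balanced_sum d (\<lambda>i. f (i + 2 ^ d)))"

lemma lessThan_double: "{..<2 * m} = {..<m} \<union> (\<lambda>i. i + m) ` {..<(m::nat)}"
proof
  show "{..<2 * m} \<subseteq> {..<m} \<union> (\<lambda>i. i + m) ` {..<m}"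
  proof
    fix x assume "x \<in> {..<2 * m}"
    then have "x < m \<or> x = (x - m) + m \<and> x - m < m" by auto
    then show "x \<in> {..<m} \<union> (\<lambda>i. i + m) ` {..<m}" by blast
  qed
qed auto

lemma teval_balanced_sum: "teval (balanced_sum d f) a = (\<Sum>i<2 ^ d. teval (f i) a)"
proof (induction d arbitrary: f)
  case (Suc d)
  have "(\<Sum>i<2 ^ Suc d. teval (f i) a) =
      (\<Sum>i<2 ^ d. teval (f i) a) + (\<Sum>i\<in>(\<lambda>i. i + 2 ^ d) ` {..<2 ^ d}. teval (f i) a)"
    unfolding power_Suc lessThan_double by (rule sum.union_disjoint) auto
  then show ?case by (simp add: Suc sum.reindex)
qed simp

lemma tvars_balanced_sum: "tvars (balanced_sum d f) = (\<Union>i<2 ^ d. tvars (f i))"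
  by (induction d arbitrary: f) (auto simp: lessThan_double)

lemma syntactically_multilinear_balanced_sum:
  "(\<And>i. i < 2 ^ d \<Longrightarrow> syntactically_multilinear (f i)) \<Longrightarrow> syntactically_multilinear (balanced_sum d f)"
  by (induction d arbitrary: f) auto

lemma depth_balanced_sum:
  "(\<And>i. i < 2 ^ d \<Longrightarrow> depth (f i) \<le> m) \<Longrightarrow> depth (balanced_sum d f) \<le> d + m"
proof (induction d arbitrary: f)
  case (Suc d)
  have "depth (balanced_sum d f) \<le> d + m" "depth (balanced_sum d (\<lambda>i. f (i + 2 ^ d))) \<le> d + m"
    by (rule Suc.IH, rule Suc.prems, simp)+
  then show ?case by simp
qed simp

text \<open>\<open>I\<close> holds the additions. The subterms of the summands stay uncounted
  because different gates share them.\<close>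

lemma subterms_balanced_sum:
  "\<exists>I. finite I \<and> card I < 2 ^ d \<and> subterms (balanced_sum d f) \<subseteq> I \<union> (\<Union>i<2 ^ d. subterms (f i))"
proof (induction d arbitrary: f)
  case 0
  then show ?case by (intro exI[of _ "{}"]) auto
next
  case (Suc d)
  let ?g = "\<lambda>i. f (i + 2 ^ d)"
  obtain I where I: "finite I" "card I < 2 ^ d"
    "subterms (balanced_sum d f) \<subseteq> I \<union> (\<Union>i<2 ^ d. subterms (f i))"
    using Suc by blast
  obtain J where J: "finite J" "card J < 2 ^ d"
    "subterms (balanced_sum d ?g) \<subseteq> J \<union> (\<Union>i<2 ^ d. subterms (?g i))"
    using Suc[of ?g] by blast
  let ?K = "insert (balanced_sum (Suc d) f) (I \<union> J)"
  have "card ?K \<le> Suc (card (I \<union> J))" using I J by (simp add: card_insert_if)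
  also have "\<dots> \<le> Suc (card I + card J)" using card_Un_le[of I J] by simp
  also have "\<dots> < 2 ^ Suc d" using I J by simp
  finally have "card ?K < 2 ^ Suc d" .
  moreover have sub: "(\<Union>i<2 ^ d. subterms (f i)) \<union> (\<Union>i<2 ^ d. subterms (?g i)) \<subseteq>
      (\<Union>i<2 ^ Suc d. subterms (f i))"
    unfolding power_Suc lessThan_double by blast
  have "insert t (A \<union> B) \<subseteq> insert t (I \<union> J) \<union> L"
    if "A \<subseteq> I \<union> L1" "B \<subseteq> J \<union> L2" "L1 \<union> L2 \<subseteq> L" for t :: "'a aterm" and A B L L1 L2
    using that by blast
  from this[OF I(3) J(3) sub]
  have "subterms (balanced_sum (Suc d) f) \<subseteq> ?K \<union> (\<Union>i<2 ^ Suc d. subterms (f i))"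
    by (simp only: balanced_sum.simps subterms.simps)
  ultimately show ?case using I(1) J(1) by (intro exI[of _ ?K]) simp
qed

section \<open>Shapes, selectors and the recursive circuit\<close>

definition pair_term :: "nat set \<Rightarrow> 'a::comm_ring_1 aterm" where
  "pair_term S = AAdd (AVar (Min S)) (AMul (AConst (-1)) (AVar (Max S)))"

lemma Min_Max_card_2:
  fixes S :: "nat set"
  assumes "card S = 2"
  shows "S = {Min S, Max S}" "Min S < Max S"
proof -
  obtain i j where "S = {i, j}" "i \<noteq> j" using assms by (auto simp: card_2_iff)
  then have "S = {Min S, Max S} \<and> Min S < Max S" by (cases i j rule: linorder_cases) auto
  then show "S = {Min S, Max S}" "Min S < Max S" by blast+
qed

text \<open>Shapes are coded by numbers below \<open>2 ^ r\<close>, so that a pair of pieces is a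
  number below \<open>2 ^ (2 * r)\<close>, over which a \<open>balanced_sum\<close> can run, and a
  selector has a computable index.\<close>

locale shape_codes =
  fixes sh :: "nat \<Rightarrow> nat set" and n r :: nat
  assumes sh_sub: "sh c \<subseteq> {..<n}"
begin

text \<open>Balance is not asked for, because one circuit must serve all partitions; the selectors
  pick the splitting that suits a given one.\<close>

definition admissible :: "nat \<Rightarrow> nat \<Rightarrow> nat \<Rightarrow> bool" where
  "admissible c c1 c2 \<longleftrightarrow> sh c1 \<noteq> {} \<and> sh c2 \<noteq> {} \<and> sh c1 \<inter> sh c2 = {} \<and> sh c1 \<union> sh c2 = sh c"

text \<open>
  The auxiliary variable that switches on the splitting of the shape with code \<open>c\<close> into the shapes
  with codes \<open>e div 2 ^ r\<close> and \<open>e mod 2 ^ r\<close>. The code \<open>c\<close> can be read off the index, so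
  the variables below disjoint shapes are disjoint.
\<close>

definition selector :: "nat \<Rightarrow> nat \<Rightarrow> nat" where
  "selector e c = n + (e * 2 ^ r + c)"

definition gate :: "(nat \<Rightarrow> 'a::comm_ring_1 aterm) \<Rightarrow> nat \<Rightarrow> nat \<Rightarrow> 'a aterm" where
  "gate F c e = (if admissible c (e div 2 ^ r) (e mod 2 ^ r)
     then AMul (AVar (selector e c)) (AMul (F (e div 2 ^ r)) (F (e mod 2 ^ r)))
     else AConst 0)"

text \<open>A pair is a leaf at every level \<open>k\<close>, since the pieces of one shape may
  reach size two after different numbers of steps.\<close>

primrec circ :: "nat \<Rightarrow> nat \<Rightarrow> 'a::comm_ring_1 aterm" where
  "circ 0 c = (if card (sh c) = 2 then pair_term (sh c) else AConst 0)"
| "circ (Suc k) c = (if card (sh c) = 2 then pair_term (sh c)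
     else balanced_sum (2 * r) (gate (circ k) c))"

text \<open>All selectors that can occur below \<open>c\<close>. Empty shapes are excluded, as they
  would lie below disjoint shapes at once.\<close>

definition selectors :: "nat \<Rightarrow> nat set" where
  "selectors c = {i. n \<le> i \<and> i < n + 2 ^ (3 * r) \<and>
     sh ((i - n) mod 2 ^ r) \<noteq> {} \<and> sh ((i - n) mod 2 ^ r) \<subseteq> sh c}"

lemma code_bounds: "e < 2 ^ (2 * r) \<Longrightarrow> e div 2 ^ r < 2 ^ r \<and> e mod 2 ^ r < 2 ^ r" for e :: nat
  by (simp add: less_mult_imp_div_less power_mult power2_eq_square mult_2 power_add)

lemma selector_bound:
  assumes "e < 2 ^ (2 * r)" "c < 2 ^ r"
  shows "selector e c < n + 2 ^ (3 * r)"
proof -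
  have "e * 2 ^ r + c < Suc e * 2 ^ r" using assms(2) by simp
  also have "\<dots> \<le> 2 ^ (2 * r) * 2 ^ r" using assms(1) by (intro mult_right_mono) auto
  also have "\<dots> = 2 ^ (3 * r)" by (simp flip: power_add)
  finally show ?thesis by (simp add: selector_def)
qed

lemma selector_mod: "c < 2 ^ r \<Longrightarrow> (selector e c - n) mod 2 ^ r = c"
  by (simp add: selector_def)

lemma selector_inj: "selector e c = selector e' c \<Longrightarrow> e = e'"
  by (simp add: selector_def)

text \<open>Each piece misses the other, nonempty one, so it does not contain the whole shape. Hence
  the selector of \<open>c\<close> does not occur again below it, as multilinearity of the gate
  demands.\<close>

lemma selector_in_selectors:
  assumes "admissible c c1 c2" "e < 2 ^ (2 * r)" "c < 2 ^ r"
  shows "selector e c \<in> selectors c" "selector e c \<notin> selectors c1" "selector e c \<notin> selectors c2"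
  using assms selector_bound[OF assms(2,3)] selector_mod[OF assms(3), of e]
  by (auto simp: selectors_def admissible_def selector_def[of e c])

lemma selectors_mono: "sh c1 \<subseteq> sh c \<Longrightarrow> selectors c1 \<subseteq> selectors c"
  by (auto simp: selectors_def)

lemma selectors_disjoint: "sh c1 \<inter> sh c2 = {} \<Longrightarrow> selectors c1 \<inter> selectors c2 = {}"
  by (auto simp: selectors_def)

lemma sh_selectors: "sh c1 \<inter> selectors c2 = {}"
  using sh_sub[of c1] by (auto simp: selectors_def)

lemma tvars_pair_term: "card S = 2 \<Longrightarrow> tvars (pair_term S :: 'a::comm_ring_1 aterm) = S"
proof -
  assume "card S = 2"
  then have "{Min S, Max S} = S" using Min_Max_card_2(1) by blast
  moreover have "tvars (pair_term S :: 'a aterm) = {Min S, Max S}" by (auto simp: pair_term_def)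
  ultimately show ?thesis by simp
qed

lemma tvars_gate:
  assumes "c < 2 ^ r" "e < 2 ^ (2 * r)" "\<And>c. c < 2 ^ r \<Longrightarrow> tvars (F c) \<subseteq> sh c \<union> selectors c"
  shows "tvars (gate F c e) \<subseteq> sh c \<union> selectors c"
proof (cases "admissible c (e div 2 ^ r) (e mod 2 ^ r)")
  case True
  have sub: "sh (e div 2 ^ r) \<subseteq> sh c" "sh (e mod 2 ^ r) \<subseteq> sh c"
    using True by (auto simp: admissible_def)
  moreover note selectors_mono[OF sub(1)] selectors_mono[OF sub(2)]
  moreover have "tvars (F (e div 2 ^ r)) \<subseteq> sh (e div 2 ^ r) \<union> selectors (e div 2 ^ r)"
    "tvars (F (e mod 2 ^ r)) \<subseteq> sh (e mod 2 ^ r) \<union> selectors (e mod 2 ^ r)"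
    using assms(3) code_bounds[OF assms(2)] by blast+
  moreover have "selector e c \<in> selectors c"
    by (rule selector_in_selectors[OF True assms(2,1)])
  moreover have "tvars (gate F c e) = {selector e c} \<union> (tvars (F (e div 2 ^ r)) \<union> tvars (F (e mod 2 ^ r)))"
    using True by (simp add: gate_def)
  ultimately show ?thesis by (simp only:) blast
qed (simp add: gate_def)

lemma tvars_circ: "c < 2 ^ r \<Longrightarrow> tvars (circ k c :: 'a::comm_ring_1 aterm) \<subseteq> sh c \<union> selectors c"
proof (induction k arbitrary: c)
  case (Suc k)
  have "tvars (gate (circ k) c e :: 'a aterm) \<subseteq> sh c \<union> selectors c" if "e < 2 ^ (2 * r)" for e
    by (rule tvars_gate[OF Suc.prems that Suc.IH])
  then show ?case by (auto simp: tvars_balanced_sum tvars_pair_term)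
qed (auto simp: tvars_pair_term)

lemma admissible_disjoint:
  assumes "admissible c c1 c2" "c1 < 2 ^ r" "c2 < 2 ^ r"
  shows "tvars (circ k c1 :: 'a::comm_ring_1 aterm) \<inter> tvars (circ k c2 :: 'a aterm) = {}"
proof -
  have "sh c1 \<inter> sh c2 = {}" using assms(1) by (simp add: admissible_def)
  then have "(sh c1 \<union> selectors c1) \<inter> (sh c2 \<union> selectors c2) = {}"
    using selectors_disjoint[of c1 c2] sh_selectors[of c1 c2] sh_selectors[of c2 c1] by auto
  then show ?thesis
    using tvars_circ[OF assms(2), where k=k and 'a='a] tvars_circ[OF assms(3), where k=k and 'a='a]
    by (meson Int_mono subset_empty subset_trans equalityD1 disjoint_iff subsetD)
qed

lemma selector_notin_circ:
  assumes "admissible c c1 c2" "c < 2 ^ r" "c1 < 2 ^ r" "c2 < 2 ^ r" "e < 2 ^ (2 * r)"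
  shows "selector e c \<notin> tvars (circ k c1 :: 'a::comm_ring_1 aterm)"
    "selector e c \<notin> tvars (circ k c2 :: 'a aterm)"
proof -
  have "selector e c \<notin> sh c'" for c' using sh_sub[of c'] by (auto simp: selector_def)
  then show "selector e c \<notin> tvars (circ k c1 :: 'a aterm)" "selector e c \<notin> tvars (circ k c2 :: 'a aterm)"
    using selector_in_selectors[OF assms(1,5,2)] tvars_circ[OF assms(3), where k=k and 'a='a]
      tvars_circ[OF assms(4), where k=k and 'a='a]
    by blast+
qed

lemma syntactically_multilinear_circ:
  "c < 2 ^ r \<Longrightarrow> syntactically_multilinear (circ k c :: 'a::comm_ring_1 aterm)"
proof (induction k arbitrary: c)
  case (Suc k)
  have "syntactically_multilinear (gate (circ k) c e :: 'a aterm)" if e: "e < 2 ^ (2 * r)" for e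
  proof (cases "admissible c (e div 2 ^ r) (e mod 2 ^ r)")
    case True
    note cb = code_bounds[OF e, THEN conjunct1] code_bounds[OF e, THEN conjunct2]
    show ?thesis
      using True Suc.IH[OF cb(1)] Suc.IH[OF cb(2)] admissible_disjoint[OF True cb, where k=k and 'a='a]
        selector_notin_circ[OF True Suc.prems cb e, where k=k and 'a='a]
      by (simp add: gate_def)
  qed (simp add: gate_def)
  then show ?case
    by (auto simp: pair_term_def intro: syntactically_multilinear_balanced_sum)
qed (auto simp: pair_term_def)

lemma teval_circ_Ints:
  assumes "\<And>i. a i \<in> \<int>"
  shows "teval (circ k c) a \<in> \<int>"
proof (induction k arbitrary: c)
  case (Suc k)
  then show ?case using assms
    by (auto simp: pair_term_def teval_balanced_sum gate_def intro!: Ints_sum Ints_mult Ints_add Ints_diff)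
qed (use assms in \<open>auto simp: pair_term_def\<close>)

lemma depth_circ: "depth (circ k c :: 'a::comm_ring_1 aterm) \<le> 2 + k * (2 * r + 2)"
proof (induction k arbitrary: c)
  case (Suc k)
  have "depth (gate (circ k) c e :: 'a aterm) \<le> 2 + (2 + k * (2 * r + 2))" for e
    using Suc[of "e div 2 ^ r"] Suc[of "e mod 2 ^ r"] by (auto simp: gate_def)
  then have "depth (balanced_sum (2 * r) (gate (circ k) c) :: 'a aterm) \<le> 2 * r + (2 + (2 + k * (2 * r + 2)))"
    by (rule depth_balanced_sum)
  then show ?case by (auto simp: pair_term_def)
qed (auto simp: pair_term_def)

text \<open>Counting the subterms of all codes at one level together expresses the sharing: besides
  pair terms, a new level adds only the additions and at most four nodes for each splitting of each
  code.\<close>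

lemma card_subterms_circ:
  "card (\<Union>c<2 ^ r. subterms (circ k c :: 'a::comm_ring_1 aterm)) \<le> Suc k * (10 * 2 ^ (3 * r))"
proof (induction k)
  have pair: "card (subterms (pair_term S :: 'a aterm)) \<le> 5" for S
  proof -
    have "subterms (pair_term S :: 'a aterm) = set [pair_term S, AVar (Min S),
        AMul (AConst (-1)) (AVar (Max S)), AConst (-1), AVar (Max S)]"
      by (auto simp: pair_term_def)
    then show ?thesis
      using card_length[of "[pair_term S, AVar (Min S), AMul (AConst (-1)) (AVar (Max S)),
        AConst (-1), AVar (Max S) :: 'a aterm]"] by simp
  qed
  {
    case 0
    have "card (\<Union>c<2 ^ r. subterms (circ 0 c :: 'a aterm)) \<le> (\<Sum>c<(2::nat) ^ r. card (subterms (circ 0 c :: 'a aterm)))"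
      by (rule card_UN_le) simp
    also have "\<dots> \<le> (\<Sum>c<(2::nat) ^ r. 5)"
      by (intro sum_mono) (use pair in auto)
    also have "\<dots> \<le> 10 * 2 ^ (3 * r)"
    proof -
      have "(2::nat) ^ r \<le> 2 ^ (3 * r)" by (rule power_increasing) auto
      moreover have "(\<Sum>c<(2::nat) ^ r. 5) = 5 * (2::nat) ^ r" by simp
      ultimately show ?thesis by linarith
    qed
    finally show ?case by simp
  next
    case (Suc k)
    let ?U = "\<lambda>k. \<Union>c<2 ^ r. subterms (circ k c :: 'a aterm)"
    have "\<exists>I. finite I \<and> card I \<le> 10 * 2 ^ (2 * r) \<and> subterms (circ (Suc k) c :: 'a aterm) \<subseteq> I \<union> ?U k" for c
    proof (cases "card (sh c) = 2")
      case True
      have "card (subterms (pair_term (sh c) :: 'a aterm)) \<le> 10 * 2 ^ (2 * r)"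
        using pair[of "sh c"] one_le_power[of "2::nat" "2 * r"] by linarith
      then show ?thesis using True
        by (intro exI[of _ "subterms (pair_term (sh c))"]) auto
    next
      case False
      obtain I where I: "finite I" "card I \<le> 2 ^ (2 * r)"
        "subterms (balanced_sum (2 * r) (gate (circ k) c) :: 'a aterm) \<subseteq>
          I \<union> (\<Union>e<2 ^ (2 * r). subterms (gate (circ k) c e))"
        using subterms_balanced_sum less_imp_le by metis
      define J where "J e = {AMul (AVar (selector e c)) (AMul (circ k (e div 2 ^ r)) (circ k (e mod 2 ^ r))),
        AVar (selector e c), AMul (circ k (e div 2 ^ r)) (circ k (e mod 2 ^ r)), AConst 0 :: 'a aterm}" for e
      have J: "card (J e) \<le> 4" "finite (J e)" for e
        by (simp_all add: J_def card_insert_if)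
      have "(\<Union>e<2 ^ (2 * r). subterms (gate (circ k) c e)) \<subseteq> (\<Union>e<2 ^ (2 * r). J e) \<union> ?U k"
      proof (rule UN_least)
        fix e :: nat assume e: "e \<in> {..<2 ^ (2 * r)}"
        have "subterms (circ k (e div 2 ^ r)) \<subseteq> ?U k" "subterms (circ k (e mod 2 ^ r)) \<subseteq> ?U k"
          using code_bounds[of e] e by (auto intro!: UN_upper)
        then have "subterms (gate (circ k) c e) \<subseteq> J e \<union> ?U k"
          by (simp add: gate_def J_def) blast
        also have "\<dots> \<subseteq> (\<Union>e<2 ^ (2 * r). J e) \<union> ?U k"
          by (rule Un_mono[OF UN_upper[OF e] order_refl])
        finally show "subterms (gate (circ k) c e) \<subseteq> (\<Union>e<2 ^ (2 * r). J e) \<union> ?U k" .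
      qed
      from order_trans[OF I(3) Un_mono[OF order_refl this]]
      have "subterms (circ (Suc k) c) \<subseteq> (I \<union> (\<Union>e<2 ^ (2 * r). J e)) \<union> ?U k"
        using False by (simp only: circ.simps if_False Un_assoc)
      moreover have "card (I \<union> (\<Union>e<2 ^ (2 * r). J e)) \<le> 10 * 2 ^ (2 * r)"
      proof -
        have "card (\<Union>e<2 ^ (2 * r). J e) \<le> (\<Sum>e<(2::nat) ^ (2 * r). card (J e))"
          by (rule card_UN_le) simp
        also have "\<dots> \<le> (\<Sum>e<(2::nat) ^ (2 * r). 4)" by (intro sum_mono J(1))
        finally have "card (\<Union>e<2 ^ (2 * r). J e) \<le> 4 * 2 ^ (2 * r)" by simp
        then show ?thesis
          using I(2) card_Un_le[of I "\<Union>e<2 ^ (2 * r). J e"] by linarith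
      qed
      ultimately show ?thesis using I(1) J(2)
        by (intro exI[of _ "I \<union> (\<Union>e<2 ^ (2 * r). J e)"] conjI) auto
    qed
    then obtain I where I: "\<And>c. finite (I c)" "\<And>c. card (I c) \<le> 10 * 2 ^ (2 * r)"
      "\<And>c. subterms (circ (Suc k) c :: 'a aterm) \<subseteq> I c \<union> ?U k" by metis
    have "?U (Suc k) \<subseteq> (\<Union>c<2 ^ r. I c) \<union> ?U k" using I(3) by blast
    then have "card (?U (Suc k)) \<le> card ((\<Union>c<2 ^ r. I c) \<union> ?U k)"
      using I(1) by (intro card_mono) auto
    also have "\<dots> \<le> card (\<Union>c<2 ^ r. I c) + card (?U k)" by (rule card_Un_le)
    also have "card (\<Union>c<2 ^ r. I c) \<le> (\<Sum>c<(2::nat) ^ r. card (I c))" by (rule card_UN_le) simp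
    also have "\<dots> \<le> (\<Sum>c<(2::nat) ^ r. 10 * 2 ^ (2 * r))" by (intro sum_mono I)
    also have "\<dots> = 10 * 2 ^ (3 * r)" by (simp flip: power_add)
    finally show ?case using Suc by simp
  }
qed

section \<open>Full rank after switching on suitable selectors\<close>

definition full :: "'a::field itself \<Rightarrow> nat set \<Rightarrow> nat \<Rightarrow> nat \<Rightarrow> bool" where
  "full TYPE('a) Y k c \<longleftrightarrow> (\<exists>U. U \<subseteq> selectors c \<and>
     full_rank Y (sh c) (bool_fun {..<n} U (circ k c :: 'a aterm)))"

lemma bool_fun_circ_vars:
  "c < 2 ^ r \<Longrightarrow> bool_fun {..<n} U (circ k c) A = bool_fun {..<n} U (circ k c) (A \<inter> sh c)"
proof (rule bool_fun_vars)
  assume "c < 2 ^ r"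
  then show "tvars (circ k c) \<inter> {..<n} \<subseteq> sh c"
    using tvars_circ[of c k] by (auto simp: selectors_def)
qed

lemma full_pair:
  assumes "card (sh c) = 2" "(\<Sum>i\<in>sh c. if i \<in> Y then 1 else - 1 :: int) = 0"
  shows "full TYPE('a::field) Y k c"
proof -
  define i j where "i = Min (sh c)" and "j = Max (sh c)"
  have ij: "sh c = {i, j}" "i < j"
    unfolding i_def j_def by (rule Min_Max_card_2[OF assms(1)])+
  have n: "i < n" "j < n" using sh_sub[of c] ij by auto
  have xor: "i \<in> Y \<longleftrightarrow> j \<notin> Y" using assms(2) ij(1,2) by (auto split: if_splits)
  have "circ k c = (pair_term (sh c) :: 'a aterm)" using assms(1) by (cases k) auto
  then have *: "bool_fun {..<n} {} (circ k c) A \<noteq> (0::'a) \<longleftrightarrow> (i \<in> A \<longleftrightarrow> j \<notin> A)" for A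
    using n by (simp add: pair_term_def bool_fun_def flip: i_def j_def)
  have "full_rank Y (sh c) (bool_fun {..<n} {} (circ k c :: 'a aterm))"
  proof (cases "i \<in> Y")
    case True
    then show ?thesis unfolding ij(1) using xor * by (intro full_rank_pair) auto
  next
    case False
    have "sh c = {j, i}" using ij(1) by auto
    then show ?thesis using False xor * by (metis full_rank_pair)
  qed
  then show ?thesis unfolding full_def by blast
qed

text \<open>Switch on the selectors chosen for both pieces and, among those of \<open>c\<close>,
  only the one for the splitting into \<open>c1\<close> and \<open>c2\<close>. All other summands
  vanish, and a product in disjoint variables remains.\<close>

lemma full_step:
  assumes adm: "admissible c c1 c2" and c: "c < 2 ^ r" "c1 < 2 ^ r" "c2 < 2 ^ r"
    and "card (sh c) \<noteq> 2" and full: "full TYPE('a::field) Y k c1" "full TYPE('a) Y k c2"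
  shows "full TYPE('a) Y (Suc k) c"
proof -
  obtain U1 where U1: "U1 \<subseteq> selectors c1"
    "full_rank Y (sh c1) (bool_fun {..<n} U1 (circ k c1 :: 'a aterm))"
    using full(1) by (auto simp: full_def)
  obtain U2 where U2: "U2 \<subseteq> selectors c2"
    "full_rank Y (sh c2) (bool_fun {..<n} U2 (circ k c2 :: 'a aterm))"
    using full(2) by (auto simp: full_def)
  define e where "e = c1 * 2 ^ r + c2"
  have e: "e div 2 ^ r = c1" "e mod 2 ^ r = c2" using c(3) by (auto simp: e_def)
  have "e < Suc c1 * 2 ^ r" using c(3) by (simp add: e_def)
  also have "\<dots> \<le> 2 ^ r * 2 ^ r" using c(2) by (intro mult_right_mono) auto
  finally have e_less: "e < 2 ^ (2 * r)" by (simp add: mult_2 power_add)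
  let ?v = "selector e c"
  define U where "U = insert ?v (U1 \<union> U2)"
  have sub: "sh c1 \<subseteq> sh c" "sh c2 \<subseteq> sh c" and disj: "sh c1 \<inter> sh c2 = {}"
    using adm by (auto simp: admissible_def)
  have v: "?v \<in> selectors c" "?v \<notin> selectors c1" "?v \<notin> selectors c2"
    using selector_in_selectors[OF adm e_less c(1)] by auto
  have tv: "tvars (circ k c1 :: 'a aterm) \<subseteq> sh c1 \<union> selectors c1"
    "tvars (circ k c2 :: 'a aterm) \<subseteq> sh c2 \<union> selectors c2"
    using tvars_circ c by blast+
  have vn: "selector e' c \<notin> sh c'" for e' c' using sh_sub[of c'] by (auto simp: selector_def)
  \<comment> \<open>What \<open>U\<close> adds to \<open>U1\<close> or to \<open>U2\<close> does not
    occur in the respective piece.\<close>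
  have eval: "bool_fun {..<n} U (circ k c1) A = (bool_fun {..<n} U1 (circ k c1) A :: 'a)"
    "bool_fun {..<n} U (circ k c2) A = (bool_fun {..<n} U2 (circ k c2) A :: 'a)" for A
    unfolding bool_fun_def
    using tv v vn U1(1) U2(1) selectors_disjoint[OF disj] sh_selectors
    by (intro teval_cong arg_cong[of _ _ of_bool]; unfold U_def; blast)+
  have "bool_fun {..<n} U (circ (Suc k) c) A =
    (bool_fun {..<n} U1 (circ k c1) A * bool_fun {..<n} U2 (circ k c2) A :: 'a)" for A
  proof -
    let ?a = "\<lambda>i. of_bool (i \<in> A \<inter> {..<n} \<union> U) :: 'a"
    have zero: "teval (gate (circ k) c e') ?a = 0" if "e' < 2 ^ (2 * r)" "e' \<noteq> e" for e'
    proof -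
      have "selector e' c \<notin> U"
        using that selector_inj[of e' c e] selector_in_selectors[OF adm that(1) c(1)] U1(1) U2(1)
        by (auto simp: U_def)
      moreover have "selector e' c \<notin> {..<n}" by (simp add: selector_def)
      ultimately show ?thesis by (auto simp: gate_def)
    qed
    have "bool_fun {..<n} U (circ (Suc k) c) A = (\<Sum>e'<2 ^ (2 * r). teval (gate (circ k) c e') ?a)"
      using assms(5) by (simp add: bool_fun_def teval_balanced_sum)
    also have "\<dots> = teval (gate (circ k) c e) ?a"
      using e_less zero by (subst sum.remove[of _ e]) auto
    also have "\<dots> = bool_fun {..<n} U (circ k c1) A * bool_fun {..<n} U (circ k c2) A"
      using adm by (simp add: gate_def e bool_fun_def U_def)
    finally show ?thesis unfolding eval .
  qed
  then have "bool_fun {..<n} U (circ (Suc k) c) =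
    (\<lambda>A. bool_fun {..<n} U1 (circ k c1) A * bool_fun {..<n} U2 (circ k c2) A :: 'a)" by blast
  moreover have "full_rank Y (sh c1 \<union> sh c2) \<dots>"
    by (rule full_rank_mult[OF U1(2) U2(2) disj bool_fun_circ_vars[OF c(2)] bool_fun_circ_vars[OF c(3)]])
  moreover have "sh c1 \<union> sh c2 = sh c" using adm by (simp add: admissible_def)
  moreover have "U \<subseteq> selectors c"
    using U1(1) U2(1) v(1) selectors_mono[OF sub(1)] selectors_mono[OF sub(2)] by (auto simp: U_def)
  ultimately show ?thesis unfolding full_def by auto
qed

text \<open>The walk that goes up on \<open>Y\<close> and down elsewhere has sum zero exactly on the
  sets that \<open>Y\<close> halves, so \<open>balanced_induct\<close> applies.\<close>

lemma full_circ:
  assumes codes: "\<And>S. two_intervals n S \<Longrightarrow> \<exists>c<2 ^ r. sh c = S"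
    and c: "c < 2 ^ r" "sh c = {..<n}" and Y: "Y \<subseteq> {..<n}" "2 * card Y = n" "0 < n"
    and j: "5 ^ j * n \<le> 2 * 6 ^ j"
  shows "full TYPE('a::field) Y (2 * j) c"
proof -
  let ?f = "\<lambda>i. if i \<in> Y then 1 else - 1 :: int"
  have "sum ?f {..<n} = sum ?f Y + sum ?f ({..<n} - Y)"
    using Y(1) by (simp add: sum.subset_diff[of Y "{..<n}"])
  also have "\<dots> = int (card Y) - int (card ({..<n} - Y))" by simp
  also have "card ({..<n} - Y) = card Y"
    using Y by (subst card_Diff_subset) (auto intro: finite_subset)
  finally have sum0: "sum ?f {..<n} = 0" by simp
  \<comment> \<open>All codes of a shape are covered because \<open>sh\<close> need not be
    injective.\<close>
  have "\<forall>c<2 ^ r. sh c = {..<n} \<longrightarrow> full TYPE('a) Y (2 * j) c"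
  proof (rule balanced_induct[where f = ?f and n = n and j = j and
      P = "\<lambda>k S. \<forall>c<2 ^ r. sh c = S \<longrightarrow> full TYPE('a) Y k c"])
    show "two_intervals n {..<n}"
      using two_intervals_single[of 0 n n] by (simp add: atLeast0LessThan)
    show "\<forall>c<2 ^ r. sh c = S \<longrightarrow> full TYPE('a) Y k c"
      if "sum ?f S = 0" "card S = 2" for k S
      using full_pair that by blast
    show "\<forall>c<2 ^ r. sh c = S \<longrightarrow> full TYPE('a) Y (Suc k) c"
      if S: "splits_into n ?f S S1 S2" "\<forall>c<2 ^ r. sh c = S1 \<longrightarrow> full TYPE('a) Y k c"
        "\<forall>c<2 ^ r. sh c = S2 \<longrightarrow> full TYPE('a) Y k c" for k S S1 S2
    proof (intro allI impI)
      fix c assume c: "c < 2 ^ r" "sh c = S"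
      show "full TYPE('a) Y (Suc k) c"
      proof (cases "card S = 2")
        case True
        have "sum ?f S = 0"
          using S(1) finite_two_intervals unfolding splits_into_def
          by (metis (no_types, lifting) add.right_neutral sum.union_disjoint)
        then show ?thesis using full_pair True c by blast
      next
        case False
        obtain c1 c2 where "c1 < 2 ^ r" "sh c1 = S1" "c2 < 2 ^ r" "sh c2 = S2"
          using codes S(1) unfolding splits_into_def by metis
        moreover have "admissible c c1 c2"
          using S(1) calculation c by (simp add: admissible_def splits_into_def)
        ultimately show ?thesis using full_step[of c c1 c2] S(2,3) False c by blast
      qed
    qed
  qed (use sum0 Y j in auto)
  then show ?thesis using c by blast
qed

end

lemma card_two_intervals: "finite {S. two_intervals n S} \<and> card {S. two_intervals n S} \<le> (n + 1) ^ 4"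
proof -
  let ?g = "\<lambda>(a, b, c, d). {a..<b} \<union> {c..<d}"
  let ?I = "{..n} \<times> {..n} \<times> {..n} \<times> {..n}"
  have sub: "{S. two_intervals n S} \<subseteq> ?g ` ?I"
    unfolding two_intervals_def by (force intro!: image_eqI)
  have fin: "finite ?I" by simp
  have "card {S. two_intervals n S} \<le> card ?I"
    using sub fin by (rule surj_card_le[rotated])
  also have "\<dots> = (n + 1) ^ 4" by (simp add: card_cartesian_product eval_nat_numeral)
  finally show ?thesis using finite_subset[OF sub] by auto
qed

section \<open>The separation\<close>

lemma exists_full_rank_circuit:
  assumes "1 \<le> l"
  shows "\<exists>C :: 'a::field aterm. syntactically_multilinear C \<and> tvars C \<subseteq> {..<2 ^ (96 * l + 13)} \<and>
    depth C \<le> 2 + 64 * l * (64 * l + 10) \<and> csize C \<le> Suc (64 * l) * (10 * 2 ^ (96 * l + 12)) \<and>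
    (\<forall>a. (\<forall>i. a i \<in> \<int>) \<longrightarrow> teval C a \<in> \<int>) \<and>
    (\<forall>Y\<subseteq>{..<2 ^ (8 * l)}. 2 * card Y = 2 ^ (8 * l) \<longrightarrow>
      (\<exists>U\<subseteq>{..<2 ^ (96 * l + 13)}. full_rank Y {..<2 ^ (8 * l)} (bool_fun {..<2 ^ (8 * l)} U C)))"
proof -
  define n :: nat where "n = 2 ^ (8 * l)"
  have n_pos: "0 < n" unfolding n_def by simp
  \<comment> \<open>There are at most \<open>(n + 1) ^ 4\<close> shapes, for which
    \<open>4 * (8 * l + 1)\<close> bits suffice.\<close>
  define r where "r = 32 * l + 4"
  let ?F = "{S. two_intervals n S}"
  obtain e where e: "bij_betw e {..<card ?F} ?F"
    using ex_bij_betw_nat_finite card_two_intervals[of n] by (metis atLeast0LessThan)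
  \<comment> \<open>Codes beyond the enumeration stand for the empty shape, which no admissible
    splitting uses.\<close>
  define sh where "sh c = (if c < card ?F then e c else {})" for c
  have "n + 1 \<le> 2 * 2 ^ (8 * l)" by (simp add: n_def)
  then have "(n + 1) ^ 4 \<le> (2 * 2 ^ (8 * l)) ^ 4" by (rule power_mono) simp
  also have "\<dots> = 2 ^ r" by (simp add: r_def power_add power_mult_distrib flip: power_mult)
  finally have card: "card ?F \<le> 2 ^ r" using card_two_intervals[of n] by simp
  have codes: "\<exists>c<2 ^ r. sh c = S" if "two_intervals n S" for S
  proof -
    have "S \<in> e ` {..<card ?F}" using e that by (auto simp: bij_betw_def)
    then obtain c where "c < card ?F" "S = e c" by auto
    then show ?thesis using card by (intro exI[of _ c]) (auto simp: sh_def)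
  qed
  have "sh c \<subseteq> {..<n}" for c
  proof (cases "c < card ?F")
    case True
    then have "two_intervals n (sh c)" using e by (auto simp: sh_def bij_betw_def)
    then show ?thesis by (auto simp: two_intervals_def)
  qed (simp add: sh_def)
  then interpret shape_codes sh n r by unfold_locales
  obtain c where c: "c < 2 ^ r" "sh c = {..<n}"
    using codes[OF two_intervals_single[of 0 n]] by (auto simp: atLeast0LessThan)
  \<comment> \<open>Since \<open>2 * 5 ^ 4 \<le> 6 ^ 4\<close>, four factors 5/6 make less than one
    half, so \<open>32 * l\<close> of them use up \<open>n = 2 ^ (8 * l)\<close>; each takes up to
    two steps.\<close>
  define k where "k = 2 * (32 * l)"
  let ?C = "circ k c :: 'a aterm"
  have "n + 2 ^ (3 * r) \<le> 2 * (2 ^ (96 * l + 12) :: nat)"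
    unfolding mult_2 by (intro add_mono) (auto simp: n_def r_def intro!: power_increasing)
  also have "\<dots> = 2 ^ (96 * l + 13)" by (simp flip: power_Suc)
  finally have bound: "n + 2 ^ (3 * r) \<le> 2 ^ (96 * l + 13)" .
  have vars: "i < 2 ^ (96 * l + 13)" if "i \<in> sh c \<or> i \<in> selectors c" for i
  proof -
    have "i < n + 2 ^ (3 * r)"
      using that
    proof
      assume "i \<in> sh c"
      then show ?thesis unfolding c(2) lessThan_iff by (rule trans_less_add1)
    next
      assume "i \<in> selectors c"
      then show ?thesis unfolding selectors_def by blast
    qed
    then show ?thesis using bound by (rule less_le_trans)
  qed
  have tv: "tvars ?C \<subseteq> {..<2 ^ (96 * l + 13)}" using tvars_circ[OF c(1), where k=k and 'a='a] vars by blast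
  have dp: "depth ?C \<le> 2 + 64 * l * (64 * l + 10)"
    using depth_circ[of k c] by (simp add: k_def r_def algebra_simps)
  have cs: "csize ?C \<le> Suc (64 * l) * (10 * 2 ^ (96 * l + 12))"
  proof -
    have "csize ?C \<le> card (\<Union>c<2 ^ r. subterms (circ k c :: 'a aterm))"
      unfolding csize_def using c(1) by (intro card_mono) auto
    also have "\<dots> \<le> Suc k * (10 * 2 ^ (3 * r))" by (rule card_subterms_circ)
    finally show ?thesis by (simp add: k_def r_def algebra_simps)
  qed
  have j: "5 ^ (32 * l) * n \<le> 2 * 6 ^ (32 * l)"
  proof -
    have four: "x ^ (32 * l) = (x ^ 4) ^ (8 * l)" for x :: nat
      unfolding power_mult[symmetric] by simp
    have "(5::nat) ^ (32 * l) * n = (5 ^ 4 * 2) ^ (8 * l)"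
      unfolding n_def power_mult_distrib four ..
    also have "\<dots> \<le> (6 ^ 4) ^ (8 * l)" by (rule power_mono) auto
    finally show ?thesis unfolding four[of 6] by linarith
  qed
  have fr: "\<exists>U\<subseteq>{..<2 ^ (96 * l + 13)}. full_rank Y {..<n} (bool_fun {..<n} U ?C)"
    if "Y \<subseteq> {..<n}" "2 * card Y = n" for Y
  proof -
    have "full TYPE('a) Y k c"
      unfolding k_def by (rule full_circ[OF codes c that n_pos j])
    then obtain U where "U \<subseteq> selectors c" "full_rank Y {..<n} (bool_fun {..<n} U ?C)"
      unfolding full_def c(2) by blast
    then show ?thesis using vars by blast
  qed
  show ?thesis
    unfolding n_def[symmetric]
  proof (intro exI[of _ ?C] conjI allI impI)
    show "teval ?C a \<in> \<int>" if "\<forall>i. a i \<in> \<int>" for a using teval_circ_Ints that by blast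
  qed (fact syntactically_multilinear_circ[OF c(1)] tv dp cs | erule (1) fr)+
qed

text \<open>The multilinear extension, as \<open>x * t1 + (1 - x) * t0\<close> in the last variable
  \<open>x\<close>. Its size is not controlled: \<open>Q\<close> itself may be hard, only its
  refutation must have a small circuit.\<close>

lemma interpolating_term:
  fixes \<phi> :: "nat set \<Rightarrow> 'a::comm_ring_1"
  shows "\<exists>t. syntactically_multilinear t \<and> tvars t \<subseteq> {..<N} \<and>
    (\<forall>A\<subseteq>{..<N}. teval t (\<lambda>i. of_bool (i \<in> A)) = \<phi> A)"
proof (induction N arbitrary: \<phi>)
  case 0
  show ?case by (rule exI[of _ "AConst (\<phi> {})"]) auto
next
  case (Suc N)
  obtain t0 where t0: "syntactically_multilinear t0" "tvars t0 \<subseteq> {..<N}"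
    "\<And>A. A \<subseteq> {..<N} \<Longrightarrow> teval t0 (\<lambda>i. of_bool (i \<in> A)) = \<phi> A"
    using Suc by blast
  obtain t1 where t1: "syntactically_multilinear t1" "tvars t1 \<subseteq> {..<N}"
    "\<And>A. A \<subseteq> {..<N} \<Longrightarrow> teval t1 (\<lambda>i. of_bool (i \<in> A)) = \<phi> (insert N A)"
    using Suc[of "\<lambda>A. \<phi> (insert N A)"] by blast
  let ?t = "AAdd (AMul (AVar N) t1) (AMul (AAdd (AConst 1) (AMul (AConst (-1)) (AVar N))) t0)"
  have "teval ?t (\<lambda>i. of_bool (i \<in> A)) = \<phi> A" if A: "A \<subseteq> {..<Suc N}" for A
  proof -
    have sub: "A - {N} \<subseteq> {..<N}" using A by (auto simp: less_Suc_eq)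
    have "teval t (\<lambda>i. of_bool (i \<in> A)) = (teval t (\<lambda>i. of_bool (i \<in> A - {N})) :: 'a)"
      if "tvars t \<subseteq> {..<N}" for t
      using that by (intro teval_cong) auto
    note eq = this[OF t0(2)] this[OF t1(2)]
    show ?thesis
    proof (cases "N \<in> A")
      case True
      then show ?thesis using t1(3)[OF sub] by (simp add: eq insert_absorb)
    next
      case False
      then have "A \<subseteq> {..<N}" using sub by auto
      then show ?thesis using t0(3) False by simp
    qed
  qed
  moreover have "syntactically_multilinear ?t" "tvars ?t \<subseteq> {..<Suc N}" using t0 t1 by auto
  ultimately show ?case by blast
qed

lemma bool_pt_iff_indicator:
  fixes a :: "nat \<Rightarrow> 'a::field"
  shows "bool_pt N a \<longleftrightarrow> (\<exists>A\<subseteq>{..<N}. a = (\<lambda>i. of_bool (i \<in> A)))"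
proof
  assume "bool_pt N a"
  then have a: "a i = 0 \<or> a i = 1 \<and> i < N" for i
    unfolding bool_pt_def by (cases "i < N") auto
  have "i < N" if "a i = 1" for i using a[of i] that by auto
  then have "{i. a i = 1} \<subseteq> {..<N}" by auto
  moreover have "a = (\<lambda>i. of_bool (i \<in> {i. a i = 1}))" using a by (auto simp: fun_eq_iff)
  ultimately show "\<exists>A\<subseteq>{..<N}. a = (\<lambda>i. of_bool (i \<in> A))" by blast
qed (auto simp: bool_pt_def)

text \<open>The factor \<open>2 + 2 * l\<close> is at most \<open>2 ^ Suc l\<close>; together with
  \<open>2 ^ (8 * l)\<close> this makes the \<open>Suc (9 * l)\<close> that the exponent has to
  spare.\<close>

lemma size_bound:
  assumes l: "11 \<le> l" and "v \<le> s" "1 \<le> s"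
    and "2 ^ ((l - 1) * (2 * l + 1)) \<le> (1 + 2 * l * v) * 2 ^ (8 * l) \<or> 2 ^ 2 ^ l \<le> 2 + 2 * l * v"
  shows "2 ^ (l * l) \<le> (s::nat)"
proof -
  have "Suc l \<le> 2 ^ l" using less_exp[of l] by (rule Suc_leI)
  then have l1: "2 + 2 * l \<le> 2 ^ Suc l" unfolding power_Suc by linarith
  have "2 + 2 * l * v \<le> (2 + 2 * l) * s"
  proof -
    have "2 + 2 * (l * v) \<le> 2 * s + 2 * (l * s)"
      using assms(2,3) mult_le_mono2[of v s l] by linarith
    then show ?thesis by (simp add: algebra_simps)
  qed
  also have "\<dots> \<le> 2 ^ Suc l * s" using l1 by (rule mult_right_mono) simp
  finally have v: "2 + 2 * l * v \<le> 2 ^ Suc l * s" .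
  show ?thesis
    using assms(4)
  proof
    assume *: "2 ^ ((l - 1) * (2 * l + 1)) \<le> (1 + 2 * l * v) * 2 ^ (8 * l)"
    obtain m where m: "l = m + 11" using l nat_le_iff_add by (metis add.commute)
    \<comment> \<open>Amounts to \<open>10 * l + 2 \<le> l * l\<close>, which is why
      \<open>l\<close> must be at least 11.\<close>
    have "l * l + Suc (9 * l) \<le> (l - 1) * (2 * l + 1)" unfolding m by (simp add: algebra_simps)
    then have "(2::nat) ^ (l * l + Suc (9 * l)) \<le> 2 ^ ((l - 1) * (2 * l + 1))" by (rule power_increasing) simp
    also have "\<dots> \<le> (2 ^ Suc l * s) * 2 ^ (8 * l)"
      using v by (intro order_trans[OF *] mult_right_mono) auto
    also have "\<dots> = 2 ^ Suc (9 * l) * s" by (simp add: mult_ac flip: power_add)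
    finally have "2 ^ Suc (9 * l) * 2 ^ (l * l) \<le> 2 ^ Suc (9 * l) * s"
      unfolding power_add by (simp only: mult.commute)
    then show ?thesis by (subst (asm) mult_le_cancel1) simp
  next
    assume *: "2 ^ 2 ^ l \<le> 2 + 2 * l * v"
    have "l * l + Suc l \<le> 2 ^ l" using l
    proof (induction l rule: dec_induct)
      case (step k)
      have "11 * k \<le> k * k" using step(1) by (rule mult_le_mono1)
      then have "k * k + 3 * k + 3 \<le> 2 * 2 ^ k" using step(1,3) by linarith
      then show ?case by (simp add: algebra_simps)
    qed simp
    then have "(2::nat) ^ (l * l + Suc l) \<le> 2 ^ 2 ^ l" by (rule power_increasing) simp
    also have "\<dots> \<le> 2 ^ Suc l * s" using * v by (rule order_trans)
    finally have "2 ^ Suc l * 2 ^ (l * l) \<le> 2 ^ Suc l * s"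
      unfolding power_add by (simp only: mult.commute)
    then show ?thesis by (subst (asm) mult_le_cancel1) simp
  qed
qed

lemma one_plus_even_nonzero:
  fixes x :: "'a::field_char_0"
  assumes "x \<in> \<int>"
  shows "1 + 2 * x \<noteq> 0"
proof
  assume *: "1 + 2 * x = 0"
  obtain z where "x = of_int z" using assms by (auto elim: Ints_cases)
  then have "of_int (1 + 2 * z) = (of_int 0 :: 'a)" using * by simp
  then have "1 + 2 * z = 0" by (simp only: of_int_eq_iff)
  then show False by presburger
qed

lemma separation:
  assumes l: "11 \<le> l" and N: "2 ^ (96 * l + 13) \<le> N"
  shows "\<exists>Q :: 'a::field_char_0 mpoly. multilinear Q \<and> pvars Q \<subseteq> {..<N} \<and> unsat_bool N Q \<and>
    (\<exists>C. ml_functional_refutation N Q (ev C) \<and> syntactically_multilinear C \<and>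
      csize C \<le> Suc (64 * l) * (10 * 2 ^ (96 * l + 12)) + 4 \<and>
      depth C \<le> 4 + 64 * l * (64 * l + 10)) \<and>
    (\<forall>F :: 'a aterm. multilinear_formula F \<and> ips_lin'_refutation N Q (ev F) \<longrightarrow> 2 ^ (l * l) \<le> fsize F)"
proof -
  define n :: nat where "n = 2 ^ (8 * l)"
  have "1 \<le> l" using l by simp
  from exists_full_rank_circuit[OF this, where 'a='a] obtain C :: "'a aterm" where C:
    "syntactically_multilinear C" "tvars C \<subseteq> {..<2 ^ (96 * l + 13)}"
    "depth C \<le> 2 + 64 * l * (64 * l + 10)" "csize C \<le> Suc (64 * l) * (10 * 2 ^ (96 * l + 12))"
    "\<And>a. (\<forall>i. a i \<in> \<int>) \<Longrightarrow> teval C a \<in> \<int>"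
    "\<And>Y. Y \<subseteq> {..<n} \<Longrightarrow> 2 * card Y = n \<Longrightarrow>
      \<exists>U\<subseteq>{..<2 ^ (96 * l + 13)}. full_rank Y {..<n} (bool_fun {..<n} U C)"
    unfolding n_def by blast
  let ?ind = "\<lambda>A i. of_bool (i \<in> A) :: 'a"
  define G where "G = AAdd (AConst 1) (AMul (AConst 2) C)"
  have G: "syntactically_multilinear G" "tvars G \<subseteq> {..<N}"
    using C(1,2) N by (auto simp: G_def)
  have G_nz: "teval G (?ind A) \<noteq> 0" for A
    using one_plus_even_nonzero[OF C(5)[of "?ind A"]] by (simp add: G_def)
  obtain t where t: "syntactically_multilinear t" "tvars t \<subseteq> {..<N}"
    "\<And>A. A \<subseteq> {..<N} \<Longrightarrow> teval t (?ind A) = inverse (teval G (?ind A))"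
    using interpolating_term[of N "\<lambda>A. inverse (teval G (?ind A))"] by blast
  have ref: "peval (ev G) a * peval (ev t) a = 1" if "bool_pt N a" for a
    using that t(3) G_nz by (auto simp: bool_pt_iff_indicator peval_ev)
  have lower: "2 ^ (l * l) \<le> fsize F"
    if F: "multilinear_formula F" "ips_lin'_refutation N (ev t) (ev F)" for F :: "'a aterm"
  proof -
    have F_eq: "teval F (?ind A) = teval G (?ind A)" if "A \<subseteq> {..<N}" for A
    proof -
      obtain h where h: "ev F * ev t + (\<Sum>i<N. h i * (Xv i ^ 2 - Xv i)) = 1"
        using F(2) by (auto simp: ips_lin'_refutation_def)
      have "peval (\<Sum>i<N. h i * (Xv i ^ 2 - Xv i)) (?ind A) = 0"
        by (auto simp: peval_sum peval_mult peval_diff power2_eq_square intro!: sum.neutral)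
      then have "peval (ev F) (?ind A) * peval (ev t) (?ind A) = 1"
        using arg_cong[OF h, of "\<lambda>p. peval p (?ind A)"] by (simp add: peval_add peval_mult)
      then show ?thesis
        using t(3)[OF that] G_nz[of A] by (simp add: peval_ev field_simps)
    qed
    obtain F' where F': "syntactically_multilinear F'" "fsize F' \<le> fsize F"
      "\<And>a. teval F' a = teval F a"
      using syntactically_multilinear_formula[OF F(1)] by metis
    define h where "h = n div 2"
    have h: "2 * h = n" using l by (cases l) (simp_all add: h_def n_def)
    have rank: "\<exists>U. \<forall>r. rk_le Y (bool_fun {..<2 * h} U F') r \<longrightarrow> 2 ^ h \<le> r + 1"
      if Y: "Y \<subseteq> {..<2 * h}" "card Y = h" for Y
    proof -
      obtain U where U: "U \<subseteq> {..<2 ^ (96 * l + 13)}" "full_rank Y {..<n} (bool_fun {..<n} U C)"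
        using C(6)[of Y] Y h by auto
      have nN: "n \<le> N" using N unfolding n_def
        by (rule order_trans[rotated]) (simp add: power_increasing)
      \<comment> \<open>On the cube \<open>C\<close> is \<open>(F - 1) / 2\<close>, so its rank
        exceeds that of \<open>F\<close> by at most one.\<close>
      have "bool_fun {..<n} U C A = inverse 2 * (bool_fun {..<n} U F' A + (- 1))" for A
      proof -
        have "A \<inter> {..<n} \<union> U \<subseteq> {..<N}" using U(1) N nN by fastforce
        then have "bool_fun {..<n} U F' A = teval G (?ind (A \<inter> {..<n} \<union> U))"
          unfolding bool_fun_def F'(3) by (rule F_eq)
        then show ?thesis by (simp add: G_def bool_fun_def)
      qed
      then have CF: "bool_fun {..<n} U C = (\<lambda>A. inverse 2 * (bool_fun {..<n} U F' A + (- 1)))" by blast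
      have "2 ^ h \<le> r + 1" if "rk_le Y (bool_fun {..<n} U F') r" for r
      proof -
        have "rk_le Y (bool_fun {..<n} U C) (1 * (r + 1))"
          unfolding CF by (intro rk_le_mult rk_le_add rk_le_const that)
        from full_rank_lower_bound[OF U(2) this] have "2 ^ card ({..<n} \<inter> Y) \<le> r + 1" by simp
        moreover have "{..<n} \<inter> Y = Y" using Y(1) h by auto
        ultimately show ?thesis using Y(2) by simp
      qed
      then show ?thesis unfolding h by blast
    qed
    have "2 ^ ((l - 1) * (2 * l + 1)) \<le> (1 + 2 * l * var_leaves F') * 2 ^ (8 * l) \<or>
        2 ^ 2 ^ l \<le> 2 + 2 * l * var_leaves F'"
      by (rule multilinear_formula_lower_bound[OF F'(1) \<open>1 \<le> l\<close> h[unfolded n_def] rank])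
    moreover have "1 \<le> fsize F'" by (cases F') auto
    ultimately have "2 ^ (l * l) \<le> fsize F'"
      using size_bound[OF l var_leaves_le_fsize] by blast
    then show ?thesis using F'(2) by simp
  qed
  have "csize G \<le> csize C + 4"
  proof -
    have "subterms G = set [G, AConst 1, AMul (AConst 2) C, AConst 2] \<union> subterms C"
      by (auto simp: G_def)
    then have "csize G \<le> card (set [G, AConst 1, AMul (AConst 2) C, AConst 2]) + csize C"
      unfolding csize_def using card_Un_le by metis
    also have "\<dots> \<le> 4 + csize C"
      using card_length[of "[G, AConst 1, AMul (AConst 2) C, AConst 2]"] by simp
    finally show ?thesis by simp
  qed
  then have size: "csize G \<le> Suc (64 * l) * (10 * 2 ^ (96 * l + 12)) + 4" using C(4) by linarith
  have depth: "depth G \<le> 4 + 64 * l * (64 * l + 10)" using C(3) by (simp add: G_def)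
  have "ml_functional_refutation N (ev t) (ev G)"
    unfolding ml_functional_refutation_def
    using multilinear_ev[OF G(1)] pvars_ev[of G] G(2) ref by blast
  moreover have "unsat_bool N (ev t)"
    unfolding unsat_bool_def using ref by fastforce
  moreover have "multilinear (ev t)" "pvars (ev t) \<subseteq> {..<N}"
    using multilinear_ev[OF t(1)] pvars_ev[of t] t(2) by auto
  ultimately show ?thesis using G(1) size depth lower by blast
qed

text \<open>Take the largest \<open>l\<close> with \<open>2 ^ (96 * l + 13) \<le> N\<close>. Then
  \<open>N\<close> is below \<open>2 ^ (96 * l + 109)\<close>, so \<open>l\<close> and
  \<open>ln N\<close> agree up to a constant factor.\<close>

lemma numeric_bounds:
  assumes N: "2 ^ (96 * 11 + 13) \<le> N"
  obtains l where "11 \<le> l" "2 ^ (96 * l + 13) \<le> N"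
    "real (Suc (64 * l) * (10 * 2 ^ (96 * l + 12)) + 4) \<le> 5000 * real N ^ 2"
    "real (4 + 64 * l * (64 * l + 10)) \<le> 5000 * (ln (real N))\<^sup>2"
    "real N powr (1 / 22472 * ln (real N)) \<le> real (2 ^ (l * l))"
proof -
  have "1 \<le> N" using N one_le_power[of "2::nat" "96 * 11 + 13"] by linarith
  then obtain L where L: "2 ^ L \<le> N" "N < 2 ^ (L + 1)"
    using ex_power_ivl1[of 2 N] by auto
  have "(2::nat) ^ (96 * 11 + 13) < 2 ^ (L + 1)" using N L(2) by (rule le_less_trans)
  then have L11: "96 * 11 + 13 \<le> L" by (subst (asm) power_strict_increasing_iff) auto
  have ln2: "1 / 2 \<le> ln (2::real)"
  proof -
    have "exp (1 / 2 :: real) ^ 2 = exp 1" by (simp add: power2_eq_square flip: exp_add)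
    then have "exp (1 / 2 :: real) ^ 2 \<le> 2 ^ 2" using exp_le by simp
    then have "exp (1 / 2 :: real) \<le> 2" by (rule power2_le_imp_le) simp
    then show ?thesis by (subst ln_ge_iff) auto
  qed
  define l where "l = (L - 13) div 96"
  have l: "11 \<le> l" "96 * l + 13 \<le> L" "L + 1 \<le> 96 * l + 109"
    using L11 unfolding l_def by auto
  have "(2::nat) ^ (96 * l + 13) \<le> 2 ^ L" using l(2) by (intro power_increasing) auto
  then have Nl: "2 ^ (96 * l + 13) \<le> N" using L(1) by linarith
  have "(2::nat) ^ (L + 1) \<le> 2 ^ (96 * l + 109)" using l(3) by (intro power_increasing) auto
  then have Nu: "N \<le> 2 ^ (96 * l + 109)" using L(2) by linarith
  have N0: "0 < real N" using \<open>1 \<le> N\<close> by simp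
  define y where "y = ln (real N)"
  have "y \<le> ln (real (2 ^ (96 * l + 109)))"
    unfolding y_def using N0 Nu by (subst ln_le_cancel_iff) (simp_all only: of_nat_le_iff of_nat_power zero_less_power of_nat_numeral, simp_all)
  also have "\<dots> = real (96 * l + 109) * ln 2" by (simp add: ln_realpow)
  also have "\<dots> \<le> real (96 * l + 109) * 1" using ln_2_less_1 by (intro mult_left_mono) auto
  \<comment> \<open>\<open>96 * l + 109 \<le> 106 * l\<close> holds from \<open>l = 11\<close>
    on.\<close>
  also have "\<dots> \<le> 106 * real l" using l(1) by simp
  finally have yu: "y \<le> 106 * real l" .
  have "real l \<le> real (96 * l + 13) * (1 / 2)" by simp
  also have "\<dots> \<le> real (96 * l + 13) * ln 2" using ln2 by (intro mult_left_mono) auto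
  also have "\<dots> = ln (real (2 ^ (96 * l + 13)))" by (simp add: ln_realpow)
  also have "\<dots> \<le> y"
    unfolding y_def using N0 Nl by (subst ln_le_cancel_iff) (simp_all only: of_nat_le_iff, simp_all)
  finally have yl: "real l \<le> y" .
  show thesis
  proof (rule that[OF l(1) Nl])
    have "Suc (64 * l) \<le> 2 ^ (96 * l + 13)"
      using less_exp[of "96 * l + 13"] by linarith
    then have 1: "Suc (64 * l) \<le> N" using Nl by linarith
    have "(2::nat) ^ (96 * l + 12) \<le> 2 ^ (96 * l + 13)" by (intro power_increasing) auto
    then have 2: "2 ^ (96 * l + 12) \<le> N" using Nl by linarith
    have "Suc (64 * l) * (10 * 2 ^ (96 * l + 12)) + 4 \<le> N * (10 * N) + 4 * (N * N)"
      using 1 2 \<open>1 \<le> N\<close> by (intro add_mono mult_mono) auto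
    also have "\<dots> \<le> 5000 * N ^ 2" by (simp add: power2_eq_square)
    finally have "real (Suc (64 * l) * (10 * 2 ^ (96 * l + 12)) + 4) \<le> real (5000 * N ^ 2)"
      by (simp only: of_nat_le_iff)
    then show "real (Suc (64 * l) * (10 * 2 ^ (96 * l + 12)) + 4) \<le> 5000 * real N ^ 2" by simp
    \<comment> \<open>The leading coefficient is \<open>64 * 64 = 4096\<close>; 5000 leaves room for
      the lower terms.\<close>
    have "4 + 64 * l * (64 * l + 10) \<le> 5000 * l ^ 2"
    proof -
      have "11 * l \<le> l * l" using l(1) by (rule mult_le_mono1)
      moreover have "4 + 64 * l * (64 * l + 10) = 4 + 4096 * (l * l) + 640 * l" by (simp add: algebra_simps)
      ultimately show ?thesis using l(1) unfolding power2_eq_square by linarith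
    qed
    then have "real (4 + 64 * l * (64 * l + 10)) \<le> real (5000 * l ^ 2)" by (simp only: of_nat_le_iff)
    also have "\<dots> \<le> 5000 * y\<^sup>2" using yl by (simp add: power_mono)
    finally show "real (4 + 64 * l * (64 * l + 10)) \<le> 5000 * (ln (real N))\<^sup>2" unfolding y_def .
    \<comment> \<open>The constant is \<open>22472 = 2 * 106 ^ 2\<close>, with the factor 2 coming
      from \<open>1 / 2 \<le> ln 2\<close>.\<close>
    have "y * y \<le> (106 * real l) * (106 * real l)" using yu yl by (intro mult_mono) auto
    then have "1 / 22472 * y * y \<le> real (l * l) * (1 / 2)" by simp
    also have "\<dots> \<le> real (l * l) * ln 2" using ln2 by (intro mult_left_mono) auto
    finally have "exp (1 / 22472 * y * y) \<le> exp (real (l * l) * ln 2)" by simp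
    also have "\<dots> = real (2 ^ (l * l))" by (subst exp_of_nat_mult) simp
    finally show "real N powr (1 / 22472 * ln (real N)) \<le> real (2 ^ (l * l))"
      using N0 by (simp add: powr_def y_def)
  qed
qed

theorem theorem1p7:
  shows "\<exists>(Q :: nat \<Rightarrow> 'a::field_char_0 mpoly) (c::real) (d::nat) (e::real) (N0::nat).
    c > 0 \<and> e > 0 \<and>
    (\<forall>N\<ge>N0.
       multilinear (Q N) \<and> pvars (Q N) \<subseteq> {..<N} \<and> unsat_bool N (Q N) \<and>
       (\<exists>G C. ml_functional_refutation N (Q N) G \<and> ev C = G \<and>
              syntactically_multilinear C \<and>
              real (csize C) \<le> c * real N ^ d \<and>
              real (depth C) \<le> c * (ln (real N))\<^sup>2) \<and>
       (\<forall>F :: 'a aterm. multilinear_formula F \<and> ips_lin'_refutation N (Q N) (ev F) \<longrightarrow>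
              real (fsize F) \<ge> real N powr (e * ln (real N))))"
proof -
  let ?P = "\<lambda>N (Q :: 'a mpoly). multilinear Q \<and> pvars Q \<subseteq> {..<N} \<and> unsat_bool N Q \<and>
       (\<exists>G C. ml_functional_refutation N Q G \<and> ev C = G \<and>
              syntactically_multilinear C \<and>
              real (csize C) \<le> 5000 * real N ^ 2 \<and>
              real (depth C) \<le> 5000 * (ln (real N))\<^sup>2) \<and>
       (\<forall>F :: 'a aterm. multilinear_formula F \<and> ips_lin'_refutation N Q (ev F) \<longrightarrow>
              real (fsize F) \<ge> real N powr (1 / 22472 * ln (real N)))"
  have "\<exists>Q. ?P N Q" if N: "2 ^ (96 * 11 + 13) \<le> N" for N
  proof -
    obtain l where l: "11 \<le> l" "2 ^ (96 * l + 13) \<le> N"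
      "real (Suc (64 * l) * (10 * 2 ^ (96 * l + 12)) + 4) \<le> 5000 * real N ^ 2"
      "real (4 + 64 * l * (64 * l + 10)) \<le> 5000 * (ln (real N))\<^sup>2"
      "real N powr (1 / 22472 * ln (real N)) \<le> real (2 ^ (l * l))"
      using numeric_bounds[OF N] by blast
    obtain Q :: "'a mpoly" and C where Q: "multilinear Q" "pvars Q \<subseteq> {..<N}" "unsat_bool N Q"
      and C: "ml_functional_refutation N Q (ev C)" "syntactically_multilinear C"
        "csize C \<le> Suc (64 * l) * (10 * 2 ^ (96 * l + 12)) + 4"
        "depth C \<le> 4 + 64 * l * (64 * l + 10)"
      and F: "\<And>F :: 'a aterm. multilinear_formula F \<Longrightarrow> ips_lin'_refutation N Q (ev F) \<Longrightarrow>
        2 ^ (l * l) \<le> fsize F"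
      using separation[OF l(1,2)] by blast
    have "real (csize C) \<le> 5000 * real N ^ 2" "real (depth C) \<le> 5000 * (ln (real N))\<^sup>2"
      using order_trans[OF _ l(3)] order_trans[OF _ l(4)] C(3,4) by (simp_all only: of_nat_le_iff)
    moreover have "real N powr (1 / 22472 * ln (real N)) \<le> real (fsize F)"
      if "multilinear_formula F" "ips_lin'_refutation N Q (ev F)" for F :: "'a aterm"
      using order_trans[OF l(5)] F[OF that] by (simp only: of_nat_le_iff)
    ultimately show ?thesis using Q C(1,2) by blast
  qed
  then obtain Q where "\<And>N. 2 ^ (96 * 11 + 13) \<le> N \<Longrightarrow> ?P N (Q N)" by metis
  then show ?thesis
    by (intro exI[of _ Q] exI[of _ "5000"] exI[of _ "2"] exI[of _ "1 / 22472"]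
        exI[of _ "2 ^ (96 * 11 + 13)"]) auto
qed

end
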